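(* Let $\phi=\tilde p/p$ be a rational inner function on $\mathbb{D}^2$ that does not extend continuously to $\overline{\mathbb{D}^2}$. Then $\frac{\partial\phi}{\partial z_j}\notin H^{\mathfrak p}(\mathbb{D}^2)$ for $j=1,2$ and all $\frac32\le\mathfrak p\le\infty$.
   Context: $\phi=\tilde p/p$ where $p\in\mathbb{C}[z_1,z_2]$ has bidegree $(m,n)$, no zeros in $\mathbb{D}^2$, is atoral (finitely many zeros on $\mathbb{T}^2$, no common factor with $\tilde p$), and $\tilde p(z)=z_1^mz_2^n\overline{p(1/\bar z_1,1/\bar z_2)}$. $H^{\mathfrak p}(\mathbb{D}^2)$ for $0<\mathfrak p<\infty$ consists of holomorphic $f$ with $\sup_{0<r<1}\frac{1}{4\pi^2}\int_{\mathbb{T}^2}|f(r\zeta)|^{\mathfrak p}|d\zeta|<\infty$; $H^\infty(\mathbb{D}^2)$ is the space of bounded holomorphic functions. *)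

theory Defs
  imports "HOL-Analysis.Analysis"
begin

definition poly2 :: "(nat \<Rightarrow> nat \<Rightarrow> complex) \<Rightarrow> nat \<Rightarrow> nat \<Rightarrow> complex \<times> complex \<Rightarrow> complex" where
  "poly2 a m n z = (\<Sum>i\<le>m. \<Sum>j\<le>n. a i j * fst z ^ i * snd z ^ j)"

definition has_bidegree :: "(nat \<Rightarrow> nat \<Rightarrow> complex) \<Rightarrow> nat \<Rightarrow> nat \<Rightarrow> bool" where
  "has_bidegree a m n \<longleftrightarrow> (\<exists>j\<le>n. a m j \<noteq> 0) \<and> (\<exists>i\<le>m. a i n \<noteq> 0)"

text \<open>The reflection p~(z) = z1^m z2^n conj(p(1/conj z1, 1/conj z2)), written out.\<close>
definition refl2 :: "(nat \<Rightarrow> nat \<Rightarrow> complex) \<Rightarrow> nat \<Rightarrow> nat \<Rightarrow> complex \<times> complex \<Rightarrow> complex" where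
  "refl2 a m n z = (\<Sum>i\<le>m. \<Sum>j\<le>n. cnj (a i j) * fst z ^ (m - i) * snd z ^ (n - j))"

definition bidisk :: "(complex \<times> complex) set" where
  "bidisk = {z. norm (fst z) < 1 \<and> norm (snd z) < 1}"

definition closed_bidisk :: "(complex \<times> complex) set" where
  "closed_bidisk = {z. norm (fst z) \<le> 1 \<and> norm (snd z) \<le> 1}"

definition torus2 :: "(complex \<times> complex) set" where
  "torus2 = {z. norm (fst z) = 1 \<and> norm (snd z) = 1}"

definition is_poly2_fun :: "(complex \<times> complex \<Rightarrow> complex) \<Rightarrow> bool" where
  "is_poly2_fun f \<longleftrightarrow> (\<exists>N c. \<forall>z. f z = (\<Sum>i\<le>N. \<Sum>j\<le>N. c i j * fst z ^ i * snd z ^ j))"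

definition common_factor2 :: "(complex \<times> complex \<Rightarrow> complex) \<Rightarrow> (complex \<times> complex \<Rightarrow> complex) \<Rightarrow> bool" where
  "common_factor2 f g \<longleftrightarrow> (\<exists>q r s. is_poly2_fun q \<and> is_poly2_fun r \<and> is_poly2_fun s \<and>
      \<not> (\<exists>k. \<forall>z. q z = k) \<and> (\<forall>z. f z = q z * r z) \<and> (\<forall>z. g z = q z * s z))"

definition atoral :: "(nat \<Rightarrow> nat \<Rightarrow> complex) \<Rightarrow> nat \<Rightarrow> nat \<Rightarrow> bool" where
  "atoral a m n \<longleftrightarrow> finite {z \<in> torus2. poly2 a m n z = 0} \<and>
      \<not> common_factor2 (poly2 a m n) (refl2 a m n)"

definition holo2_on :: "(complex \<times> complex \<Rightarrow> complex) \<Rightarrow> (complex \<times> complex) set \<Rightarrow> bool" where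
  "holo2_on f U \<longleftrightarrow> (\<forall>z\<in>U. \<exists>D. (f has_derivative D) (at z) \<and>
      (\<forall>c w. D (c * fst w, c * snd w) = c * D w))"

definition hardy2 :: "ereal \<Rightarrow> (complex \<times> complex \<Rightarrow> complex) \<Rightarrow> bool" where
  "hardy2 P f \<longleftrightarrow> holo2_on f bidisk \<and>
     (if P = \<infinity> then (\<exists>B. \<forall>z\<in>bidisk. norm (f z) \<le> B)
      else (SUP r\<in>{0<..<1::real}.
              ennreal (1 / (4 * pi ^ 2)) *
              (\<integral>\<^sup>+ x \<in> {0..2*pi} \<times> {0..2*pi}.
                 ennreal (norm (f (of_real r * cis (fst x), of_real r * cis (snd x))) powr real_of_ereal P)
               \<partial>(lborel :: (real \<times> real) measure))) < \<infinity>)"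

definition pderiv1 :: "(complex \<times> complex \<Rightarrow> complex) \<Rightarrow> complex \<times> complex \<Rightarrow> complex" where
  "pderiv1 f z = deriv (\<lambda>w. f (w, snd z)) (fst z)"

definition pderiv2 :: "(complex \<times> complex \<Rightarrow> complex) \<Rightarrow> complex \<times> complex \<Rightarrow> complex" where
  "pderiv2 f z = deriv (\<lambda>w. f (fst z, w)) (snd z)"

end

theory Submission
  imports Defs "HOL-Complex_Analysis.Complex_Analysis"
    "HOL-Computational_Algebra.Fundamental_Theorem_Algebra"
begin

text \<open>
  By Hurwitz, the only zeros of \<open>p\<close> in the closed bidisk lie on the torus, so a discontinuous \<open>\<phi>\<close>
  forces a zero \<open>(c, v)\<close> there. For \<open>w\<close> on the unit circle, \<open>\<phi>(\<cdot>, w)\<close> is a finite Blaschke product,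
  and \<open>|\<partial>\<phi>/\<partial>z\<^sub>1|\<close> on the circle is a sum of Poisson kernels, one for each root \<open>b\<close> of \<open>p(\<cdot>, w)\<close>;
  hence \<open>\<integral> |\<partial>\<phi>/\<partial>z\<^sub>1|\<^sup>P\<close> over the circle is at least a multiple of \<open>(|b| - 1)\<close> to the power \<open>-1/2\<close> when
  \<open>P \<ge> 3/2\<close>. The roots near \<open>c\<close> satisfy \<open>|b| - 1 = O(t\<^sup>2)\<close> for \<open>w = v e\<^bsup>it\<^esup>\<close>: the sum of
  \<open>(b - c)/(b + c)\<close> over them is holomorphic in \<open>w\<close>, vanishes at \<open>v\<close>, and has nonnegative real part on
  the circle, so its real part has a minimum at \<open>t = 0\<close>. Thus the double integral dominates \<open>\<integral> dt/t\<close>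
  and diverges, while Fatou's lemma would make it finite for a derivative in the Hardy space.
\<close>

subsection \<open>Slices of a bivariate polynomial and its reflection\<close>

text \<open>The truncated exponent \<open>i - 1\<close> at \<open>i = 0\<close> is harmless: that term has the factor \<open>of_nat 0\<close>.\<close>

definition poly2_d1 :: "(nat \<Rightarrow> nat \<Rightarrow> complex) \<Rightarrow> nat \<Rightarrow> nat \<Rightarrow> complex \<times> complex \<Rightarrow> complex" where
  "poly2_d1 a m n z = (\<Sum>i\<le>m. \<Sum>j\<le>n. a i j * (of_nat i * fst z ^ (i - 1)) * snd z ^ j)"

definition poly2_d2 :: "(nat \<Rightarrow> nat \<Rightarrow> complex) \<Rightarrow> nat \<Rightarrow> nat \<Rightarrow> complex \<times> complex \<Rightarrow> complex" where
  "poly2_d2 a m n z = (\<Sum>i\<le>m. \<Sum>j\<le>n. a i j * fst z ^ i * (of_nat j * snd z ^ (j - 1)))"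

definition poly2_d12 :: "(nat \<Rightarrow> nat \<Rightarrow> complex) \<Rightarrow> nat \<Rightarrow> nat \<Rightarrow> complex \<times> complex \<Rightarrow> complex" where
  "poly2_d12 a m n z =
     (\<Sum>i\<le>m. \<Sum>j\<le>n. a i j * (of_nat i * fst z ^ (i - 1)) * (of_nat j * snd z ^ (j - 1)))"

text \<open>Packaged as a \<open>poly\<close> in the first variable, so that root factorisation,
  degree and finiteness of the root set are available. For particular \<open>w\<close> the degree
  can fall below \<open>m\<close>.\<close>

definition slice :: "(nat \<Rightarrow> nat \<Rightarrow> complex) \<Rightarrow> nat \<Rightarrow> nat \<Rightarrow> complex \<Rightarrow> complex poly" where
  "slice a m n w = (\<Sum>i\<le>m. monom (\<Sum>j\<le>n. a i j * w ^ j) i)"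

text \<open>Makes the reflection another instance of \<open>poly2\<close>, so that the derivative
  and continuity facts for \<open>poly2\<close> cover it too.\<close>

definition refl_coeff :: "(nat \<Rightarrow> nat \<Rightarrow> complex) \<Rightarrow> nat \<Rightarrow> nat \<Rightarrow> nat \<Rightarrow> nat \<Rightarrow> complex" where
  "refl_coeff a m n i j = cnj (a (m - i) (n - j))"

text \<open>The quotient rule for \<open>refl2 / poly2\<close>, taken as a formula on the whole
  plane so that it can also be evaluated on the torus. At zeros of \<open>poly2\<close> division by
  zero gives the value 0, on which \<open>isCont_phi_d1\<close> relies.\<close>

definition phi_d1 :: "(nat \<Rightarrow> nat \<Rightarrow> complex) \<Rightarrow> nat \<Rightarrow> nat \<Rightarrow> complex \<times> complex \<Rightarrow> complex" where
  "phi_d1 a m n z =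
     (poly2_d1 (refl_coeff a m n) m n z * poly2 a m n z - refl2 a m n z * poly2_d1 a m n z)
       / (poly2 a m n z)\<^sup>2"

lemma refl2_eq_poly2: "refl2 a m n = poly2 (refl_coeff a m n) m n"
proof
  fix z
  have "refl2 a m n z = (\<Sum>i\<le>m. \<Sum>j\<le>n. cnj (a (m - i) j) * fst z ^ (m - (m - i)) * snd z ^ (n - j))"
    unfolding refl2_def
    by (rule sum.nat_diff_reindex[symmetric, where n = "Suc m", simplified lessThan_Suc_atMost, simplified])
  also have "\<dots> = (\<Sum>i\<le>m. \<Sum>j\<le>n. cnj (a (m - i) (n - j)) * fst z ^ (m - (m - i)) * snd z ^ (n - (n - j)))"
    by (intro sum.cong refl sum.nat_diff_reindex[symmetric, where n = "Suc n", simplified lessThan_Suc_atMost, simplified])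
  also have "\<dots> = poly2 (refl_coeff a m n) m n z"
    unfolding poly2_def refl_coeff_def by (intro sum.cong refl) auto
  finally show "refl2 a m n z = poly2 (refl_coeff a m n) m n z" .
qed

lemma poly2_has_derivative_1:
  "((\<lambda>z. poly2 a m n (z, w)) has_field_derivative poly2_d1 a m n (z, w)) (at z within S)"
  unfolding poly2_def poly2_d1_def
  by (auto intro!: derivative_eq_intros sum.cong simp: mult_ac)

lemma poly2_has_derivative_2:
  "((\<lambda>w. poly2 a m n (z, w)) has_field_derivative poly2_d2 a m n (z, w)) (at w within S)"
  unfolding poly2_def poly2_d2_def
  by (auto intro!: derivative_eq_intros sum.cong simp: mult_ac)

lemma poly2_d1_has_derivative_2:
  "((\<lambda>w. poly2_d1 a m n (z, w)) has_field_derivative poly2_d12 a m n (z, w)) (at w within S)"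
  unfolding poly2_d12_def poly2_d1_def
  by (auto intro!: derivative_eq_intros sum.cong simp: mult_ac)

lemma continuous_on_poly2 [continuous_intros]: "continuous_on S (poly2 a m n)"
  unfolding poly2_def by (intro continuous_intros)

lemma continuous_on_poly2_d1: "continuous_on S (poly2_d1 a m n)"
  unfolding poly2_d1_def by (intro continuous_intros)

lemma continuous_on_poly2_d2: "continuous_on S (poly2_d2 a m n)"
  unfolding poly2_d2_def by (intro continuous_intros)

lemma continuous_on_poly2_d12: "continuous_on S (poly2_d12 a m n)"
  unfolding poly2_d12_def by (intro continuous_intros)

lemma poly_slice: "poly (slice a m n w) z = poly2 a m n (z, w)"
  unfolding slice_def poly2_def by (simp add: poly_sum poly_monom sum_distrib_right sum_distrib_left mult_ac)

lemma poly_pderiv_slice: "poly (pderiv (slice a m n w)) z = poly2_d1 a m n (z, w)"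
proof -
  have "((\<lambda>z. poly (slice a m n w) z) has_field_derivative poly (pderiv (slice a m n w)) z) (at z)"
    by (rule poly_DERIV)
  then have "((\<lambda>z. poly2 a m n (z, w)) has_field_derivative poly (pderiv (slice a m n w)) z) (at z)"
    by (simp add: poly_slice)
  then show ?thesis
    using poly2_has_derivative_1 DERIV_unique by blast
qed

lemma degree_slice: "degree (slice a m n w) \<le> m"
  unfolding slice_def by (rule degree_sum_le) (auto intro: order.trans[OF degree_monom_le])

section \<open>Logarithmic derivatives of polynomials without zeros in the closed disc\<close>

text \<open>For \<open>norm b > 1\<close> the right-hand side is the Poisson kernel of the reflected
  point \<open>1 / cnj b\<close>: the contribution of one root to the modulus of the derivative of a
  Blaschke product.\<close>

lemma one_minus_Re_root_term:
  fixes z b :: complex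
  assumes "norm z = 1" "z \<noteq> b"
  shows "1 - 2 * Re (z / (z - b)) = ((norm b)\<^sup>2 - 1) / (norm (z - b))\<^sup>2"
proof -
  have nz: "(norm (z - b))\<^sup>2 \<noteq> 0" using assms by simp
  have "Re (z / (z - b)) = Re (z * cnj (z - b)) / (norm (z - b))\<^sup>2"
    by (subst complex_div_cnj) (metis Re_divide_of_real of_real_power)
  moreover have "(norm (z - b))\<^sup>2 - 2 * Re (z * cnj (z - b)) = (norm b)\<^sup>2 - (norm z)\<^sup>2"
    unfolding cmod_power2 by (simp add: power2_eq_square algebra_simps)
  ultimately show ?thesis using nz assms(1)
    by (simp add: field_simps)
qed

lemma log_deriv_linear_factor:
  fixes q :: "complex poly"
  assumes "z \<noteq> b" "poly q z \<noteq> 0"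
  shows "z * poly (pderiv ([:-b, 1:] * q)) z / poly ([:-b, 1:] * q) z =
           z * poly (pderiv q) z / poly q z + z / (z - b)"
proof -
  have "poly (pderiv ([:-b, 1:] * q)) z = (z - b) * poly (pderiv q) z + poly q z"
    unfolding pderiv_mult by (simp add: pderiv_pCons algebra_simps)
  moreover have "poly ([:-b, 1:] * q) z = (z - b) * poly q z"
    by (simp add: algebra_simps)
  ultimately show ?thesis
    using assms by (simp add: add_divide_distrib distrib_left mult.left_commute)
qed

text \<open>Splitting off the roots one at a time, each root \<open>b\<close> adds
  \<open>z / (z - b)\<close> to the logarithmic derivative and 1 to the degree; its Poisson kernel
  is nonnegative because \<open>norm b > 1\<close>.\<close>

lemma log_deriv_poly_bound:
  fixes p :: "complex poly"
  assumes "\<And>z. norm z \<le> 1 \<Longrightarrow> poly p z \<noteq> 0" "norm z = 1"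
  shows "2 * Re (z * poly (pderiv p) z / poly p z) \<le> real (degree p)"
  using assms(1)
proof (induction "degree p" arbitrary: p)
  case 0
  then obtain c where "p = [:c:]" by (metis degree_eq_zeroE)
  then show ?case by simp
next
  case (Suc d)
  then have "\<not> constant (poly p)" by (simp add: constant_degree)
  then obtain b where b: "poly p b = 0" using fundamental_theorem_of_algebra by blast
  then obtain q where q: "p = [:-b, 1:] * q" by (metis dvdE poly_eq_0_iff_dvd)
  have nb: "norm b > 1" using b Suc.prems by force
  have "q \<noteq> 0" using q Suc.hyps by auto
  have dq: "degree p = Suc (degree q)" unfolding q using \<open>q \<noteq> 0\<close> by (subst degree_mult_eq) auto
  have qz: "\<And>z. norm z \<le> 1 \<Longrightarrow> poly q z \<noteq> 0" using Suc.prems q by auto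
  have IH: "2 * Re (z * poly (pderiv q) z / poly q z) \<le> real (degree q)"
    using Suc.hyps dq qz by auto
  have zb: "z \<noteq> b" using nb assms(2) by auto
  have "z * poly (pderiv p) z / poly p z = z * poly (pderiv q) z / poly q z + z / (z - b)"
    unfolding q using zb qz[of z] assms(2) by (intro log_deriv_linear_factor) auto
  moreover have "2 * Re (z / (z - b)) \<le> 1"
    using one_minus_Re_root_term[OF assms(2) zb] nb
    by (smt (verit) divide_nonneg_nonneg one_le_power zero_le_power2)
  ultimately show ?case using IH dq by simp
qed

text \<open>The kernel of the chosen root is kept exactly, while the contribution of the remaining
  factor \<open>q\<close> is discarded by \<open>log_deriv_poly_bound\<close>.\<close>

lemma log_deriv_poly_bound_root:
  fixes p :: "complex poly"
  assumes nz: "\<And>z. norm z \<le> 1 \<Longrightarrow> poly p z \<noteq> 0" and z: "norm z = 1" and b: "poly p b = 0"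
  shows "((norm b)\<^sup>2 - 1) / (norm (z - b))\<^sup>2
           \<le> real (degree p) - 2 * Re (z * poly (pderiv p) z / poly p z)"
proof -
  obtain q where q: "p = [:-b, 1:] * q" using b by (metis dvdE poly_eq_0_iff_dvd)
  have zb: "z \<noteq> b" using nz[of z] z b by auto
  have qz: "\<And>z. norm z \<le> 1 \<Longrightarrow> poly q z \<noteq> 0" using nz q by auto
  then have "q \<noteq> 0" by (metis norm_zero poly_0 zero_le_one)
  then have dq: "degree p = Suc (degree q)" unfolding q by (subst degree_mult_eq) auto
  have "z * poly (pderiv p) z / poly p z = z * poly (pderiv q) z / poly q z + z / (z - b)"
    unfolding q using zb qz[of z] z by (intro log_deriv_linear_factor) auto
  then show ?thesis
    using log_deriv_poly_bound[of q z, OF qz z] one_minus_Re_root_term[OF z zb] dq by simp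
qed

section \<open>The reflection and the derivative of \<open>\<phi>\<close> on the torus\<close>

lemma cnj_unimodular_power_diff:
  fixes z :: complex
  assumes "norm z = 1" "i \<le> m"
  shows "z ^ (m - i) = z ^ m * cnj (z ^ i)"
proof -
  have "z ^ i * cnj (z ^ i) = 1"
    using assms(1) complex_norm_square[of "z ^ i"] by (simp add: norm_power)
  moreover have "z ^ m = z ^ (m - i) * z ^ i"
    using assms(2) by (simp flip: power_add)
  ultimately show ?thesis by (simp add: mult.assoc)
qed

lemma refl2_on_torus:
  assumes "norm z = 1" "norm w = 1"
  shows "refl2 a m n (z, w) = z ^ m * w ^ n * cnj (poly2 a m n (z, w))"
proof -
  have "refl2 a m n (z, w) = (\<Sum>i\<le>m. \<Sum>j\<le>n. cnj (a i j) * (z ^ m * cnj (z ^ i)) * (w ^ n * cnj (w ^ j)))"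
    unfolding refl2_def
    by (intro sum.cong refl) (simp add: cnj_unimodular_power_diff[OF assms(1)]
        cnj_unimodular_power_diff[OF assms(2)])
  also have "\<dots> = z ^ m * w ^ n * cnj (poly2 a m n (z, w))"
    unfolding poly2_def by (simp add: sum_distrib_left mult_ac)
  finally show ?thesis .
qed

lemma refl2_d1_on_torus:
  assumes "norm z = 1" "norm w = 1"
  shows "z * poly2_d1 (refl_coeff a m n) m n (z, w) =
    z ^ m * w ^ n * (of_nat m * cnj (poly2 a m n (z, w)) - cnj (z * poly2_d1 a m n (z, w)))"
proof -
  have "((\<lambda>z. refl2 a m n (z, w)) has_field_derivative
      (\<Sum>i\<le>m. \<Sum>j\<le>n. cnj (a i j) * (of_nat (m - i) * z ^ (m - i - 1)) * w ^ (n - j))) (at z)"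
    unfolding refl2_def by (auto intro!: derivative_eq_intros sum.cong simp: mult_ac)
  then have d: "poly2_d1 (refl_coeff a m n) m n (z, w) =
      (\<Sum>i\<le>m. \<Sum>j\<le>n. cnj (a i j) * (of_nat (m - i) * z ^ (m - i - 1)) * w ^ (n - j))"
    unfolding refl2_eq_poly2 using poly2_has_derivative_1 DERIV_unique by blast
  \<comment> \<open>At \<open>k = 0\<close> the truncated exponent would spoil this identity, but
    there the factor \<open>of_nat k\<close> vanishes.\<close>
  have aux: "z * (of_nat k * z ^ (k - 1)) = of_nat k * z ^ k" for k :: nat
    by (cases k) auto
  have "z * poly2_d1 (refl_coeff a m n) m n (z, w) =
      (\<Sum>i\<le>m. \<Sum>j\<le>n. cnj (a i j) * (z * (of_nat (m - i) * z ^ (m - i - 1))) * w ^ (n - j))"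
    unfolding d by (simp add: sum_distrib_left mult_ac)
  also have "\<dots> = (\<Sum>i\<le>m. \<Sum>j\<le>n. cnj (a i j) * (of_nat (m - i) * z ^ (m - i)) * w ^ (n - j))"
    by (simp only: aux)
  also have "\<dots> = (\<Sum>i\<le>m. \<Sum>j\<le>n. cnj (a i j) * ((of_nat m - of_nat i) * (z ^ m * cnj (z ^ i)))
      * (w ^ n * cnj (w ^ j)))"
    by (intro sum.cong refl) (simp add: cnj_unimodular_power_diff[OF assms(1)]
        cnj_unimodular_power_diff[OF assms(2)] of_nat_diff)
  also have "\<dots> = z ^ m * w ^ n * (\<Sum>i\<le>m. \<Sum>j\<le>n. of_nat m * cnj (a i j * z ^ i * w ^ j) -
      cnj (a i j * (of_nat i * z ^ i) * w ^ j))"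
    by (simp add: sum_distrib_left algebra_simps)
  also have "\<dots> = z ^ m * w ^ n * (of_nat m * cnj (poly2 a m n (z, w)) -
      cnj (\<Sum>i\<le>m. \<Sum>j\<le>n. a i j * (z * (of_nat i * z ^ (i - 1))) * w ^ j))"
    unfolding poly2_def aux by (simp add: sum_subtractf sum_distrib_left)
  also have "(\<Sum>i\<le>m. \<Sum>j\<le>n. a i j * (z * (of_nat i * z ^ (i - 1))) * w ^ j) = z * poly2_d1 a m n (z, w)"
    unfolding poly2_d1_def by (simp add: sum_distrib_left mult_ac)
  finally show ?thesis .
qed

text \<open>After multiplication by \<open>z\<close>, the reflection formulas turn the numerator
  into a unimodular factor times \<open>m * |p|^2 - 2 * Re (u * cnj p)\<close>, which is real;
  dividing by \<open>|p|^2\<close> leaves the logarithmic derivative.\<close>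

lemma norm_phi_d1_on_torus:
  assumes z: "norm z = 1" and w: "norm w = 1" and nz: "poly2 a m n (z, w) \<noteq> 0"
  shows "norm (phi_d1 a m n (z, w)) = \<bar>real m - 2 * Re (z * poly2_d1 a m n (z, w) / poly2 a m n (z, w))\<bar>"
proof -
  define p where "p = poly2 a m n (z, w)"
  define u where "u = z * poly2_d1 a m n (z, w)"
  have p0: "p \<noteq> 0" using nz p_def by simp
  have "z * phi_d1 a m n (z, w) =
      (z * poly2_d1 (refl_coeff a m n) m n (z, w) * p - refl2 a m n (z, w) * u) / p\<^sup>2"
    unfolding phi_d1_def p_def u_def by (simp add: algebra_simps diff_divide_distrib)
  also have "\<dots> = z ^ m * w ^ n * (of_nat m * (cnj p * p) - (cnj u * p + cnj p * u)) / p\<^sup>2"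
    unfolding refl2_d1_on_torus[OF z w] refl2_on_torus[OF z w] p_def[symmetric] u_def[symmetric]
    by (simp add: algebra_simps)
  finally have "norm (phi_d1 a m n (z, w)) =
      norm (of_nat m * (cnj p * p) - (cnj u * p + cnj p * u)) / (norm p)\<^sup>2"
    using z w by (metis (no_types, lifting) mult_1 norm_divide norm_mult norm_power power_one)
  also have "of_nat m * (cnj p * p) - (cnj u * p + cnj p * u) =
      of_real (real m * (norm p)\<^sup>2 - 2 * Re (u * cnj p))"
    unfolding cmod_power2 by (simp add: complex_eq_iff power2_eq_square algebra_simps)
  also have "norm (complex_of_real (real m * (norm p)\<^sup>2 - 2 * Re (u * cnj p))) / (norm p)\<^sup>2 =
      \<bar>(real m * (norm p)\<^sup>2 - 2 * Re (u * cnj p)) / (norm p)\<^sup>2\<bar>"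
    by (simp only: norm_of_real abs_divide abs_power2 abs_norm_cancel power_abs)
  also have "(real m * (norm p)\<^sup>2 - 2 * Re (u * cnj p)) / (norm p)\<^sup>2 = real m - 2 * Re (u / p)"
  proof -
    have "Re (u / p) = Re (u * cnj p) / (norm p)\<^sup>2"
      by (subst complex_div_cnj) (metis Re_divide_of_real of_real_power)
    then show ?thesis using p0 by (simp add: field_simps)
  qed
  finally show ?thesis unfolding p_def u_def .
qed

lemma norm_phi_d1_ge:
  assumes w: "norm w = 1" and nz: "\<And>z. norm z \<le> 1 \<Longrightarrow> poly2 a m n (z, w) \<noteq> 0"
    and b: "poly2 a m n (b, w) = 0" and z: "norm z = 1"
  shows "((norm b)\<^sup>2 - 1) / (norm (z - b))\<^sup>2 \<le> norm (phi_d1 a m n (z, w))"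
proof -
  have "((norm b)\<^sup>2 - 1) / (norm (z - b))\<^sup>2
      \<le> real (degree (slice a m n w)) - 2 * Re (z * poly2_d1 a m n (z, w) / poly2 a m n (z, w))"
    using log_deriv_poly_bound_root[of "slice a m n w" z b] nz z b by (simp add: poly_slice poly_pderiv_slice)
  then show ?thesis
    \<comment> \<open>If the degree of the slice drops below \<open>m\<close>, the modulus only
      becomes larger.\<close>
    unfolding norm_phi_d1_on_torus[OF z w nz[of z, unfolded z, OF order_refl]]
    using degree_slice[of a m n w] by linarith
qed

subsection \<open>Integrals counting the roots of a slice\<close>

lemma nonneg_Re_imp_quadratic_bound:
  fixes F :: "complex \<Rightarrow> complex"
  assumes hol: "F holomorphic_on ball 0 d" and d: "d > 0" and F0: "F 0 = 0"
    and nonneg: "\<And>t::real. \<bar>t\<bar> < d \<Longrightarrow> 0 \<le> Re (F (of_real t))"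
  shows "\<exists>C>0. \<exists>e>0. \<forall>t::real. \<bar>t\<bar> < e \<longrightarrow> Re (F (of_real t)) \<le> C * t\<^sup>2"
proof -
  \<comment> \<open>On the real axis \<open>Re F \<le> Re E\<close>, and the even function \<open>E\<close> has no linear term.\<close>
  define E where "E = (\<lambda>z. F z + F (- z))"
  have hol': "(\<lambda>z. F (- z)) holomorphic_on ball 0 d"
    by (rule holomorphic_on_compose_gen[OF _ hol, unfolded o_def]) (auto intro!: holomorphic_on_minus holomorphic_on_ident)
  have holE: "E holomorphic_on ball 0 d"
    unfolding E_def by (intro holomorphic_intros hol hol')
  have dF: "(F has_field_derivative deriv F 0) (at 0)"
    using hol d by (intro holomorphic_derivI[of _ "ball 0 d"]) auto
  have "((\<lambda>z. F (- z)) has_field_derivative deriv F 0 * (-1)) (at 0)"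
    using dF by (intro DERIV_chain2[of F _ uminus]) (auto intro!: derivative_eq_intros)
  with dF have "(E has_field_derivative deriv F 0 + deriv F 0 * (-1)) (at 0)"
    unfolding E_def by (intro DERIV_add)
  then have dE0: "deriv E 0 = 0" by (simp add: DERIV_imp_deriv)
  have hold: "(deriv ^^ k) E holomorphic_on ball 0 d" for k
    by (rule holomorphic_higher_deriv[OF holE]) auto
  have "compact ((deriv ^^ 2) E ` cball 0 (d/2))"
    by (intro compact_continuous_image holomorphic_on_imp_continuous_on holomorphic_on_subset[OF hold] compact_cball)
      (use d in auto)
  then obtain B where B: "\<And>z. z \<in> cball 0 (d/2) \<Longrightarrow> norm ((deriv ^^ 2) E z) \<le> B"
    using bounded_iff compact_imp_bounded by (metis imageI)
  have bound: "norm (E z) \<le> B * (norm z)\<^sup>2" if z: "z \<in> cball 0 (d/2)" for z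
  proof -
    \<comment> \<open>First-order Taylor expansion: value and derivative of \<open>E\<close> vanish
      at 0, so only the quadratic remainder survives.\<close>
    have "cmod ((deriv ^^ 0) E z - (\<Sum>i\<le>1. (deriv ^^ i) E 0 * (z - 0) ^ i / fact i))
        \<le> B * cmod (z - 0) ^ Suc 1 / fact 1"
    proof (rule complex_Taylor[where S = "cball 0 (d/2)"])
      fix i x assume "x \<in> cball (0::complex) (d/2)"
      then have "x \<in> ball 0 d" using d by auto
      then show "((deriv ^^ i) E has_field_derivative (deriv ^^ Suc i) E x) (at x within cball 0 (d/2))"
        using holomorphic_derivI[OF hold, of x] by (auto intro: has_field_derivative_at_within)
    qed (use z B d in \<open>auto simp: numeral_2_eq_2\<close>)
    then show ?thesis using dE0 by (simp add: E_def F0 power2_eq_square)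
  qed
  have "Re (F (of_real t)) \<le> (\<bar>B\<bar> + 1) * t\<^sup>2" if t: "\<bar>t\<bar> < d/2" for t :: real
  proof -
    have "Re (F (of_real t)) \<le> Re (E (of_real t))"
      using nonneg[of "- t"] t d by (simp add: E_def)
    also have "\<dots> \<le> norm (E (of_real t))" by (rule complex_Re_le_cmod)
    also have "\<dots> \<le> B * t\<^sup>2" using bound[of "of_real t"] t by simp
    also have "\<dots> \<le> (\<bar>B\<bar> + 1) * t\<^sup>2" by (intro mult_right_mono) auto
    finally show ?thesis .
  qed
  then show ?thesis using d by (intro exI[of _ "\<bar>B\<bar> + 1"] exI[of _ "d/2"] conjI allI impI) auto
qed

lemma Re_cayley:
  fixes z c :: complex
  shows "Re ((z - c) / (z + c)) = ((norm z)\<^sup>2 - (norm c)\<^sup>2) / (norm (z + c))\<^sup>2"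
proof -
  have "Re ((z - c) / (z + c)) = Re ((z - c) * cnj (z + c)) / (norm (z + c))\<^sup>2"
    by (subst complex_div_cnj) (metis Re_divide_of_real of_real_power)
  also have "Re ((z - c) * cnj (z + c)) = (norm z)\<^sup>2 - (norm c)\<^sup>2"
    unfolding cmod_power2 by (simp add: power2_eq_square algebra_simps)
  finally show ?thesis .
qed

lemma winding_number_circlepath_if:
  assumes "r > 0" "z \<notin> sphere c r"
  shows "winding_number (circlepath c r) z = (if z \<in> ball c r then 1 else 0)"
proof (cases "z \<in> ball c r")
  case True
  then show ?thesis by (auto simp: winding_number_circlepath dist_norm norm_minus_commute)
next
  case False
  then have "z \<notin> cball c r" using assms by auto
  then have "winding_number (circlepath c r) z = 0"
    by (intro winding_number_zero_outside[of _ "cball c r"]) (use assms in auto)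
  then show ?thesis using False by simp
qed

text \<open>The argument principle with weight \<open>h\<close>, roots counted with multiplicity
  \<open>zorder\<close>. The radius 2 suits the later weight \<open>(z - c) / (z + c)\<close> with
  \<open>norm c = 1\<close>, whose pole \<open>- c\<close> lies at distance 2 from
  \<open>c\<close>.\<close>

lemma poly2_root_count_integral:
  fixes h :: "complex \<Rightarrow> complex"
  assumes r: "0 < r" "r < 2" and nz: "\<And>z. z \<in> sphere c r \<Longrightarrow> poly2 a m n (z, w) \<noteq> 0"
    and h: "h holomorphic_on ball c 2"
  shows "contour_integral (circlepath c r) (\<lambda>z. poly2_d1 a m n (z, w) * h z / poly2 a m n (z, w))
    = 2 * pi * \<i> * (\<Sum>b | b \<in> ball c r \<and> poly2 a m n (b, w) = 0. h b * of_int (zorder (\<lambda>z. poly2 a m n (z, w)) b))"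
    and "finite {b. b \<in> ball c r \<and> poly2 a m n (b, w) = 0}"
    and "\<And>b. b \<in> ball c r \<and> poly2 a m n (b, w) = 0 \<Longrightarrow> zorder (\<lambda>z. poly2 a m n (z, w)) b > 0"
proof -
  let ?f = "\<lambda>z. poly2 a m n (z, w)"
  have "c + of_real r \<in> sphere c r" using r by (simp add: dist_norm)
  then have "slice a m n w \<noteq> 0" using nz poly_slice by (metis poly_0)
  then have fin: "finite {z. ?f z = 0}" using poly_roots_finite by (simp add: poly_slice[symmetric])
  have hol: "?f holomorphic_on S" for S
    unfolding holomorphic_on_def field_differentiable_def using poly2_has_derivative_1 by blast
  have der: "deriv ?f = (\<lambda>z. poly2_d1 a m n (z, w))"
    using poly2_has_derivative_1 DERIV_imp_deriv by blast
  \<comment> \<open>The disjunct with \<open>{}\<close> matches the form of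
    \<open>argument_principle\<close>, with an empty set of poles.\<close>
  define pz where "pz = {z \<in> ball c 2. ?f z = 0 \<or> z \<in> {}}"
  have "contour_integral (circlepath c r) (\<lambda>z. deriv ?f z * h z / ?f z) =
     2 * pi * \<i> * (\<Sum>b\<in>pz. winding_number (circlepath c r) b * h b * of_int (zorder ?f b))"
    unfolding pz_def
  proof (rule argument_principle)
    show "path_image (circlepath c r) \<subseteq> ball c 2 - {z \<in> ball c 2. ?f z = 0 \<or> z \<in> {}}"
      using r nz by auto
    show "\<forall>z. z \<notin> ball c 2 \<longrightarrow> winding_number (circlepath c r) z = 0"
      using r by (auto simp: winding_number_circlepath_if)
    show "finite {z \<in> ball c 2. ?f z = 0 \<or> z \<in> {}}" using fin by (rule rev_finite_subset) auto
  qed (auto intro: h hol)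
  also have "(\<Sum>b\<in>pz. winding_number (circlepath c r) b * h b * of_int (zorder ?f b)) =
      (\<Sum>b\<in>pz. if b \<in> ball c r then h b * of_int (zorder ?f b) else 0)"
  proof (intro sum.cong refl)
    fix b assume "b \<in> pz"
    then have "b \<notin> sphere c r" using nz unfolding pz_def by blast
    then show "winding_number (circlepath c r) b * h b * of_int (zorder ?f b) =
        (if b \<in> ball c r then h b * of_int (zorder ?f b) else 0)"
      using r by (simp add: winding_number_circlepath_if del: mem_sphere)
  qed
  also have "\<dots> = (\<Sum>b\<in>pz \<inter> ball c r. h b * of_int (zorder ?f b))"
  proof -
    have "finite pz" unfolding pz_def using fin by (rule rev_finite_subset) auto
    then show ?thesis by (simp add: sum.inter_restrict)
  qed
  also have "pz \<inter> ball c r = {b. b \<in> ball c r \<and> ?f b = 0}"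
    unfolding pz_def using r by auto
  finally show "contour_integral (circlepath c r) (\<lambda>z. poly2_d1 a m n (z, w) * h z / ?f z)
    = 2 * pi * \<i> * (\<Sum>b | b \<in> ball c r \<and> ?f b = 0. h b * of_int (zorder ?f b))"
    by (simp add: der)
  show "finite {b. b \<in> ball c r \<and> ?f b = 0}" using fin by (rule rev_finite_subset) auto
  show "zorder ?f b > 0" if b: "b \<in> ball c r \<and> ?f b = 0" for b
  proof -
    \<comment> \<open>The zeros are isolated, so the slice does not vanish identically near
      \<open>b\<close>; this makes \<open>zorder\<close> meaningful and positive.\<close>
    have "open (- ({z. ?f z = 0} - {b}))"
      using fin by (intro open_Compl finite_imp_closed) auto
    then have "\<forall>\<^sub>F z in at b. z \<in> - ({z. ?f z = 0} - {b})"
      by (rule eventually_at_in_open') auto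
    moreover have "\<forall>\<^sub>F z in at b. z \<noteq> b" by (simp add: eventually_at_filter)
    ultimately have "\<forall>\<^sub>F z in at b. ?f z \<noteq> 0" by eventually_elim auto
    then have "\<exists>\<^sub>F z in at b. ?f z \<noteq> 0" by (rule eventually_frequently[rotated]) simp
    then show ?thesis using b zorder_pos_iff[OF hol[of UNIV], of b] by auto
  qed
qed

text \<open>Single roots need not depend holomorphically on \<open>w\<close>, but weighted sums over
  all roots inside a fixed circle do: the contour integral is differentiated under the integral
  sign.\<close>

lemma holomorphic_root_count_integral:
  fixes h :: "complex \<Rightarrow> complex"
  assumes "\<And>z w. z \<in> sphere c r \<Longrightarrow> w \<in> U \<Longrightarrow> poly2 a m n (z, w) \<noteq> 0"
    and r: "r > 0" and h: "continuous_on (sphere c r) h" and U: "convex U"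
  shows "(\<lambda>w. contour_integral (circlepath c r) (\<lambda>z. poly2_d1 a m n (z, w) * h z / poly2 a m n (z, w)))
    holomorphic_on U"
proof -
  define g where "g = circlepath c r"
  \<comment> \<open>The velocity of \<open>circlepath c r\<close>, so that \<open>k w\<close> is the
    integrand in the path parameter and \<open>k'\<close> its derivative in
    \<open>w\<close>.\<close>
  define g' where "g' = (\<lambda>x::real. 2 * pi * \<i> * r * exp (2 * of_real pi * \<i> * x))"
  define k where "k = (\<lambda>w x. poly2_d1 a m n (g x, w) * h (g x) / poly2 a m n (g x, w) * g' x)"
  define k' where "k' = (\<lambda>w x. (poly2_d12 a m n (g x, w) * poly2 a m n (g x, w) -
      poly2_d1 a m n (g x, w) * poly2_d2 a m n (g x, w)) / (poly2 a m n (g x, w))\<^sup>2 * h (g x) * g' x)"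
  have gs: "g x \<in> sphere c r" for x
    using r by (simp add: g_def circlepath dist_norm norm_mult)
  have cg: "continuous_on S g" for S
    unfolding g_def circlepath by (intro continuous_intros)
  have cg': "continuous_on S g'" for S
    unfolding g'_def by (intro continuous_intros)
  have chg: "continuous_on S (\<lambda>x. h (g x))" for S
    by (rule continuous_on_compose2[OF h cg]) (use gs in auto)
  have "(\<lambda>w. integral (cbox 0 1) (k w)) holomorphic_on U"
  proof (rule leibniz_rule_holomorphic)
    fix w x assume w: "w \<in> U"
    have nz: "poly2 a m n (g x, w) \<noteq> 0" using assms(1) gs w by blast
    show "((\<lambda>w. k w x) has_field_derivative k' w x) (at w within U)"
      unfolding k_def k'_def
      by (rule derivative_eq_intros poly2_has_derivative_2 poly2_d1_has_derivative_2 refl nz)+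
        (use nz in \<open>simp add: field_simps power2_eq_square\<close>)
  next
    fix w assume w: "w \<in> U"
    have nz: "poly2 a m n (g x, w) \<noteq> 0" for x using assms(1) gs w by blast
    have "continuous_on (cbox 0 1) (k w)"
      unfolding k_def
      by (intro continuous_intros cg' chg continuous_on_compose2[OF continuous_on_poly2_d1[of UNIV]]
          continuous_on_compose2[OF continuous_on_poly2[of UNIV]] cg ballI) (use nz in auto)
    then show "k w integrable_on cbox 0 1" by (rule integrable_continuous)
  next
    have cs: "continuous_on S (\<lambda>y. g (snd y))" for S :: "(complex \<times> real) set"
      by (rule continuous_on_compose2[OF cg[of UNIV]]) (auto intro: continuous_intros)
    have cs': "continuous_on S (\<lambda>y. g' (snd y))" for S :: "(complex \<times> real) set"
      by (rule continuous_on_compose2[OF cg'[of UNIV]]) (auto intro: continuous_intros)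
    have cs'': "continuous_on S (\<lambda>y. h (g (snd y)))" for S :: "(complex \<times> real) set"
      by (rule continuous_on_compose2[OF chg[of UNIV]]) (auto intro: continuous_intros)
    have "continuous_on (U \<times> cbox 0 1) (\<lambda>y. k' (fst y) (snd y))"
      unfolding k'_def
      by (intro continuous_intros cs cs' cs'' continuous_on_compose2[OF continuous_on_poly2_d1[of UNIV]]
          continuous_on_compose2[OF continuous_on_poly2_d2[of UNIV]]
          continuous_on_compose2[OF continuous_on_poly2_d12[of UNIV]]
          continuous_on_compose2[OF continuous_on_poly2[of UNIV]] ballI) (use assms(1) gs in auto)
    then show "continuous_on (U \<times> cbox 0 1) (\<lambda>(w, x). k' w x)" by (simp add: case_prod_beta)
  qed (rule U)
  moreover have "contour_integral (circlepath c r) (\<lambda>z. poly2_d1 a m n (z, w) * h z / poly2 a m n (z, w))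
      = integral (cbox 0 1) (k w)" for w
    unfolding contour_integral_integral k_def g_def g'_def
    by (simp add: vector_derivative_circlepath)
  ultimately show ?thesis by simp
qed

subsection \<open>Contact of the zero set with the torus\<close>

text \<open>Since \<open>nz\<close> keeps all roots over the unit circle outside the open disc, the
  terms of the weighted root sum have nonnegative real part. Bounding the sum therefore bounds every
  single root. The hypothesis \<open>slice0\<close> makes \<open>c\<close> an isolated root over
  \<open>v\<close>.\<close>

lemma boundary_root_quadratic_contact:
  assumes nz: "\<And>z w. norm z < 1 \<Longrightarrow> norm w = 1 \<Longrightarrow> poly2 a m n (z, w) \<noteq> 0"
    and c: "norm c = 1" and v: "norm v = 1" and zero: "poly2 a m n (c, v) = 0"
    and slice0: "slice a m n v \<noteq> 0"
  shows "\<exists>C>0. \<exists>e>0. \<forall>t::real. \<bar>t\<bar> < e \<longrightarrow>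
           (\<exists>b. poly2 a m n (b, v * cis t) = 0 \<and> norm b \<le> 1 + C * t\<^sup>2)"
proof -
  define p where "p = poly2 a m n"
  have fin: "finite {z. p (z, v) = 0}"
    using poly_roots_finite[OF slice0] by (simp add: poly_slice p_def)
  \<comment> \<open>A circle around \<open>c\<close> that avoids the roots over \<open>v\<close>;
    its radius is below 1, which also stays away from the pole \<open>- c\<close> of
    \<open>M\<close>.\<close>
  obtain r where r: "r > 0" and r1: "\<And>z. z \<in> cball c r \<Longrightarrow> z \<in> ball c 1 \<and> (z \<noteq> c \<longrightarrow> p (z, v) \<noteq> 0)"
    using finite_cball_avoid[OF open_ball fin, of c c 1] by auto
  have "c + of_real r \<in> cball c r" using r by (simp add: dist_norm)
  from r1[OF this] have rlt: "r < 1" using r by (simp add: dist_norm)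
  have cont: "continuous_on S p" for S unfolding p_def by (rule continuous_on_poly2)
  have "\<exists>z0\<in>sphere c r. \<forall>z\<in>sphere c r. norm (p (z0, v)) \<le> norm (p (z, v))"
  proof (rule continuous_attains_inf)
    show "sphere c r \<noteq> {}" using r by auto
    show "continuous_on (sphere c r) (\<lambda>z. norm (p (z, v)))"
      by (intro continuous_intros continuous_on_compose2[OF cont[of UNIV]]) auto
  qed auto
  then obtain z0 where z0: "z0 \<in> sphere c r" "\<And>z. z \<in> sphere c r \<Longrightarrow> norm (p (z0, v)) \<le> norm (p (z, v))"
    by blast
  \<comment> \<open>The minimum of \<open>|p|\<close> over this circle. Moving \<open>w\<close> by
    less than \<open>d\<close> changes \<open>p\<close> by less than \<open>\<mu> / 2\<close>, so
    \<open>|p|\<close> remains above \<open>\<mu> / 2\<close> on the circle and below it at the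
    centre.\<close>
  define \<mu> where "\<mu> = norm (p (z0, v))"
  have \<mu>: "\<mu> > 0" using z0(1) r1[of z0] r unfolding \<mu>_def by auto
  have "uniformly_continuous_on (cball c r \<times> cball v 1) p"
    by (intro compact_uniformly_continuous cont compact_Times compact_cball)
  then obtain d0 where d0: "d0 > 0" "\<And>x y. x \<in> cball c r \<times> cball v 1 \<Longrightarrow> y \<in> cball c r \<times> cball v 1 \<Longrightarrow>
      dist y x < d0 \<Longrightarrow> dist (p y) (p x) < \<mu> / 2"
    unfolding uniformly_continuous_on_def using \<mu> by (metis half_gt_zero)
  define d where "d = min d0 1"
  have d: "d > 0" using d0(1) d_def by simp
  have close: "dist (p (z, w)) (p (z, v)) < \<mu> / 2" if "z \<in> cball c r" "w \<in> ball v d" for z w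
    using d0(2)[of "(z, v)" "(z, w)"] that by (auto simp: d_def dist_Pair_Pair dist_commute)
  have large: "norm (p (z, w)) > \<mu> / 2" if "z \<in> sphere c r" "w \<in> ball v d" for z w
  proof -
    have "\<mu> \<le> norm (p (z, v))" using z0(2) that \<mu>_def by auto
    moreover have "norm (p (z, v)) - norm (p (z, w)) \<le> dist (p (z, w)) (p (z, v))"
      by (metis dist_commute dist_norm norm_triangle_ineq2)
    ultimately show ?thesis using close[of z w] that by auto
  qed
  have nzs: "p (z, w) \<noteq> 0" if "z \<in> sphere c r" "w \<in> ball v d" for z w
    using large[OF that] \<mu> by auto
  \<comment> \<open>A holomorphic function that is smaller at the centre than on the boundary circle
    has a zero inside.\<close>
  have root: "\<exists>b. b \<in> ball c r \<and> p (b, w) = 0" if w: "w \<in> ball v d" for w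
  proof (rule holomorphic_contract_to_zero[of c r "\<lambda>z. p (z, w)"])
    show "continuous_on (cball c r) (\<lambda>z. p (z, w))"
      by (intro continuous_intros continuous_on_compose2[OF cont[of UNIV]]) auto
    show "(\<lambda>z. p (z, w)) holomorphic_on ball c r"
      unfolding holomorphic_on_def field_differentiable_def p_def using poly2_has_derivative_1 by blast
    show "norm (p (c, w)) < norm (p (z, w))" if "norm (c - z) = r" for z
      using close[of c w] large[of z w] that w r zero by (auto simp: dist_norm p_def)
  qed (use r in blast)+
  \<comment> \<open>\<open>M\<close> maps the exterior of the unit disc to the right half-plane.\<close>
  define M where "M = (\<lambda>z. (z - c) / (z + c))"
  have Mden: "z + c \<noteq> 0" if "z \<in> ball c 2" for z
  proof
    assume "z + c = 0"
    then have "z = - c" by (simp add: add_eq_0_iff2)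
    then have "norm (c - z) = 2" using c by (metis diff_minus_eq_add mult_2 norm_mult norm_numeral mult.right_neutral)
    then show False using that by (simp add: dist_norm)
  qed
  have holM: "M holomorphic_on ball c 2"
    unfolding M_def by (intro holomorphic_intros) (use Mden in auto)
  \<comment> \<open>By the argument principle this is the sum of \<open>M\<close> over the roots
    near \<open>c\<close>, with multiplicity.\<close>
  define G where "G = (\<lambda>w. contour_integral (circlepath c r) (\<lambda>z. poly2_d1 a m n (z, w) * M z / p (z, w)) / (2 * pi * \<i>))"
  have holG: "G holomorphic_on ball v d"
    unfolding G_def p_def
  proof (intro holomorphic_intros holomorphic_root_count_integral)
    show "continuous_on (sphere c r) M"
      using rlt by (intro holomorphic_on_imp_continuous_on holomorphic_on_subset[OF holM]) auto
  qed (use nzs r p_def in auto)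
  have Gsum: "G w = (\<Sum>b | b \<in> ball c r \<and> p (b, w) = 0. M b * of_int (zorder (\<lambda>z. p (z, w)) b))"
    "finite {b. b \<in> ball c r \<and> p (b, w) = 0}"
    "\<And>b. b \<in> ball c r \<and> p (b, w) = 0 \<Longrightarrow> zorder (\<lambda>z. p (z, w)) b > 0"
    if w: "w \<in> ball v d" for w
    using poly2_root_count_integral[of r c a m n w M, folded p_def] r rlt nzs w holM
    unfolding G_def by auto
  have ReM: "Re (M b) = ((norm b)\<^sup>2 - 1) / (norm (b + c))\<^sup>2" for b
    unfolding M_def using Re_cayley[of b c] c by simp
  have Gv: "G v = 0"
  proof -
    have "{b. b \<in> ball c r \<and> p (b, v) = 0} = {c}"
      using r1 r zero by (auto simp: p_def) (metis less_eq_real_def)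
    then show ?thesis using Gsum(1)[of v] d by (simp add: M_def)
  qed
  \<comment> \<open>The 9 bounds the squared denominator of \<open>Re (M b)\<close>:
    \<open>norm (b + c) \<le> norm (b - c) + 2 \<le> 3\<close>. Multiplicities are at least 1 and
    the other summands nonnegative, so one root is dominated by the whole sum.\<close>
  have lower: "\<exists>b. p (b, w) = 0 \<and> norm b \<ge> 1 \<and> ((norm b)\<^sup>2 - 1) / 9 \<le> Re (G w)"
    if w: "w \<in> ball v d" "norm w = 1" for w
  proof -
    obtain b where b: "b \<in> ball c r" "p (b, w) = 0" using root w by blast
    have outside: "norm z \<ge> 1" if "p (z, w) = 0" for z
      using nz[of z w] w that p_def by force
    have nonneg: "0 \<le> Re (M z)" if "p (z, w) = 0" for z
      unfolding ReM using outside[OF that] by (intro divide_nonneg_nonneg) auto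
    have "((norm b)\<^sup>2 - 1) / 9 \<le> Re (M b)"
    proof -
      have bc: "b + c \<noteq> 0" using Mden b rlt by auto
      have "norm (b + c) \<le> norm (b - c) + norm (c + c)"
        using norm_triangle_ineq[of "b - c" "c + c"] by (simp add: add.commute)
      also have "norm (c + c) = 2" using c by (metis mult_2 norm_mult norm_numeral mult.right_neutral)
      also have "norm (b - c) \<le> 1" using b rlt by (simp add: dist_norm norm_minus_commute)
      finally have "norm (b + c) \<le> 3" by simp
      then have "(norm (b + c))\<^sup>2 \<le> 3\<^sup>2" by (intro power_mono) auto
      then show ?thesis unfolding ReM using bc outside[OF b(2)]
        by (intro divide_left_mono) auto
    qed
    also have "\<dots> \<le> Re (M b) * of_int (zorder (\<lambda>z. p (z, w)) b)"
    proof -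
      have "1 \<le> zorder (\<lambda>z. p (z, w)) b" using Gsum(3)[OF w(1), of b] b by simp
      then have "(1::real) \<le> of_int (zorder (\<lambda>z. p (z, w)) b)" by linarith
      then show ?thesis using nonneg[OF b(2)] mult_left_mono[of 1 "of_int (zorder (\<lambda>z. p (z, w)) b)" "Re (M b)"] by simp
    qed
    also have "\<dots> \<le> (\<Sum>b | b \<in> ball c r \<and> p (b, w) = 0. Re (M b) * of_int (zorder (\<lambda>z. p (z, w)) b))"
    proof (rule member_le_sum[where f = "\<lambda>b. Re (M b) * of_int (zorder (\<lambda>z. p (z, w)) b)"])
      fix z assume "z \<in> {b. b \<in> ball c r \<and> p (b, w) = 0} - {b}"
      then have "0 < zorder (\<lambda>z. p (z, w)) z" "0 \<le> Re (M z)" using Gsum(3)[OF w(1)] nonneg by auto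
      then show "0 \<le> Re (M z) * of_int (zorder (\<lambda>z. p (z, w)) z)" by simp
    qed (use b Gsum(2)[OF w(1)] in auto)
    also have "\<dots> = Re (G w)"
      unfolding Gsum(1)[OF w(1)] by simp
    finally show ?thesis using b outside by blast
  qed
  \<comment> \<open>In the coordinate \<open>t\<close>, the real axis parametrises the arc of the
    unit circle through \<open>v\<close>.\<close>
  define F where "F = (\<lambda>t. G (v * exp (\<i> * t)))"
  have "continuous_on UNIV (\<lambda>t::complex. v * exp (\<i> * t))" by (intro continuous_intros)
  then have "open ((\<lambda>t::complex. v * exp (\<i> * t)) -` ball v d)"
    by (rule open_vimage[OF open_ball])
  moreover have "0 \<in> (\<lambda>t::complex. v * exp (\<i> * t)) -` ball v d" using d by simp
  ultimately obtain k where k: "k > 0" "ball 0 k \<subseteq> (\<lambda>t::complex. v * exp (\<i> * t)) -` ball v d"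
    using open_contains_ball by blast
  have holF: "F holomorphic_on ball 0 k"
    unfolding F_def using k(2)
    by (intro holomorphic_on_compose_gen[OF _ holG, unfolded o_def]) (auto intro!: holomorphic_intros)
  have arc: "v * cis t \<in> ball v d" "norm (v * cis t) = 1" "F (of_real t) = G (v * cis t)" if "\<bar>t\<bar> < k" for t
  proof -
    have e: "exp (\<i> * of_real t) = cis t" by (simp add: cis_conv_exp)
    have "of_real t \<in> ball (0::complex) k" using that by simp
    then have "v * exp (\<i> * of_real t) \<in> ball v d" using k(2) by blast
    then show "v * cis t \<in> ball v d" using e by simp
    show "norm (v * cis t) = 1" using v by (simp add: norm_mult)
    show "F (of_real t) = G (v * cis t)" unfolding F_def e ..
  qed
  have Fnn: "0 \<le> Re (F (of_real t))" if t: "\<bar>t\<bar> < k" for t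
  proof -
    obtain b :: complex where b: "norm b \<ge> 1" "((norm b)\<^sup>2 - 1) / 9 \<le> Re (G (v * cis t))"
      using lower arc(1,2)[OF t] by blast
    have "0 \<le> ((norm b)\<^sup>2 - 1) / 9" using b(1) by simp
    also note b(2)
    finally show ?thesis unfolding arc(3)[OF t] .
  qed
  obtain C e where C: "C > 0" and e: "e > 0" "\<And>t::real. \<bar>t\<bar> < e \<Longrightarrow> Re (F (of_real t)) \<le> C * t\<^sup>2"
    using nonneg_Re_imp_quadratic_bound[OF holF k(1) _ Fnn] Gv by (auto simp: F_def)
  have "\<exists>b. p (b, v * cis t) = 0 \<and> norm b \<le> 1 + 9 * C * t\<^sup>2" if t: "\<bar>t\<bar> < min e k" for t
  proof -
    obtain b where b: "p (b, v * cis t) = 0" "norm b \<ge> 1" "((norm b)\<^sup>2 - 1) / 9 \<le> Re (G (v * cis t))"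
      using lower arc(1,2)[of t] t by auto
    have "((norm b)\<^sup>2 - 1) / 9 \<le> C * t\<^sup>2" using b(3) e(2)[of t] arc(3)[of t] t by simp
    \<comment> \<open>Because \<open>norm b \<ge> 1\<close>, the bound on the square passes to
      \<open>norm b\<close> itself.\<close>
    moreover have "norm b \<le> (norm b)\<^sup>2" using b(2) by (rule self_le_power) simp
    ultimately show ?thesis using b(1) by (intro exI[of _ b]) auto
  qed
  then show ?thesis unfolding p_def using C e k
    by (intro exI[of _ "9 * C"] conjI exI[of _ "min e k"]) auto
qed

subsection \<open>Location of the zeros\<close>

lemma infinite_unit_circle: "infinite (sphere (0::complex) 1)"
proof
  assume fin: "finite (sphere (0::complex) 1)"
  have "connected (sphere (0::complex) 1)" by (rule connected_sphere) simp
  then have "sphere (0::complex) 1 = {} \<or> (\<exists>x. sphere (0::complex) 1 = {x})"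
    using fin connected_finite_iff_sing by blast
  moreover have "1 \<in> sphere (0::complex) 1" "-1 \<in> sphere (0::complex) 1" by auto
  ultimately have "(1::complex) = -1" by (metis empty_iff singletonD)
  then show False by simp
qed

text \<open>A vanishing slice would put a whole circle of zeros on the torus.\<close>

lemma slice_nonzero_on_circle:
  assumes fin: "finite {z \<in> torus2. poly2 a m n z = 0}" and w: "norm w = 1"
  shows "slice a m n w \<noteq> 0"
proof
  assume "slice a m n w = 0"
  then have "poly2 a m n (z, w) = 0" for z
    using poly_slice[of a m n w z] by simp
  then have "(\<lambda>z. (z, w)) ` sphere 0 1 \<subseteq> {z \<in> torus2. poly2 a m n z = 0}"
    using w by (auto simp: torus2_def)
  then have "finite ((\<lambda>z. (z, w)) ` sphere (0::complex) 1)" by (rule finite_subset[OF _ fin])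
  then have "finite (sphere (0::complex) 1)" by (rule finite_imageD) (auto intro: inj_onI)
  then show False using infinite_unit_circle by contradiction
qed

text \<open>Hurwitz's theorem: the slices over \<open>r k * w\<close> are zero-free in the disc and
  converge locally uniformly to the slice over \<open>w\<close>. Hurwitz excludes constant limits,
  so these are treated first; the constant 0 would contradict
  \<open>slice_nonzero_on_circle\<close>.\<close>

lemma poly2_nonzero_disc_times_circle:
  assumes nozero: "\<And>z w. norm z < 1 \<Longrightarrow> norm w < 1 \<Longrightarrow> poly2 a m n (z, w) \<noteq> 0"
    and fin: "finite {z \<in> torus2. poly2 a m n z = 0}"
    and z: "norm z < 1" and w: "norm w = 1"
  shows "poly2 a m n (z, w) \<noteq> 0"
proof (cases "(\<lambda>z. poly2 a m n (z, w)) constant_on ball 0 1")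
  case True
  then obtain k where k: "\<And>x. x \<in> ball 0 1 \<Longrightarrow> poly2 a m n (x, w) = k"
    unfolding constant_on_def by blast
  show ?thesis
  proof
    assume "poly2 a m n (z, w) = 0"
    then have "k = 0" using k[of z] z by simp
    then have "ball 0 1 \<subseteq> {x. poly (slice a m n w) x = 0}" using k by (auto simp: poly_slice)
    then have "finite (ball (0::complex) 1)"
      using poly_roots_finite[OF slice_nonzero_on_circle[OF fin w]] finite_subset by blast
    then have "countable (ball (0::complex) 1)" by (rule countable_finite)
    then show False using uncountable_ball[of 1 "0::complex"] by simp
  qed
next
  case False
  have hol: "(\<lambda>z. poly2 a m n (z, x)) holomorphic_on S" for x S
    unfolding holomorphic_on_def field_differentiable_def using poly2_has_derivative_1 by blast
  define r where "r = (\<lambda>k::nat. 1 - inverse (real (Suc k)))"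
  have r: "0 \<le> r k" "r k < 1" for k unfolding r_def by (auto simp: inverse_le_1_iff)
  have rlim: "r \<longlonglongrightarrow> 1"
    unfolding r_def using tendsto_diff[OF tendsto_const LIMSEQ_inverse_real_of_nat, of 1] by simp
  show ?thesis
  proof (rule Hurwitz_no_zeros[of "ball 0 1" "\<lambda>k z. poly2 a m n (z, of_real (r k) * w)" "\<lambda>z. poly2 a m n (z, w)"])
    fix K :: "complex set" assume K: "compact K" "K \<subseteq> ball 0 1"
    have "uniformly_continuous_on (K \<times> cball 0 1) (poly2 a m n)"
      by (intro compact_uniformly_continuous continuous_on_poly2 compact_Times K compact_cball)
    show "uniform_limit K (\<lambda>k z. poly2 a m n (z, of_real (r k) * w)) (\<lambda>z. poly2 a m n (z, w)) sequentially"
    proof (rule uniform_limitI)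
      fix e :: real assume "e > 0"
      with \<open>uniformly_continuous_on (K \<times> cball 0 1) (poly2 a m n)\<close>
      obtain d where d: "d > 0" "\<And>x y. x \<in> K \<times> cball 0 1 \<Longrightarrow> y \<in> K \<times> cball 0 1 \<Longrightarrow> dist y x < d \<Longrightarrow>
          dist (poly2 a m n y) (poly2 a m n x) < e"
        by (auto elim: uniformly_continuous_onE)
      have "\<forall>\<^sub>F k in sequentially. dist (r k) 1 < d" using rlim d(1) by (rule tendstoD)
      then show "\<forall>\<^sub>F k in sequentially. \<forall>x\<in>K. dist (poly2 a m n (x, of_real (r k) * w)) (poly2 a m n (x, w)) < e"
      proof eventually_elim
        case (elim k)
        have "dist (of_real (r k) * w) w = norm (of_real (r k - 1) * w)"
          by (simp add: dist_norm algebra_simps)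
        also have "\<dots> = dist (r k) 1" using w by (simp only: norm_mult norm_of_real dist_norm real_norm_def mult_1_right)
        finally have "dist (of_real (r k) * w) w < d" using elim by simp
        then have dd: "dist (x, of_real (r k) * w) (x, w) < d" for x :: complex
          by (simp add: dist_Pair_Pair)
        show ?case
        proof
          fix x assume "x \<in> K"
          then show "dist (poly2 a m n (x, of_real (r k) * w)) (poly2 a m n (x, w)) < e"
            using w r[of k] by (intro d(2) dd) (auto simp: norm_mult)
        qed
      qed
    qed
  next
    fix k x assume "x \<in> ball (0::complex) 1"
    then show "poly2 a m n (x, of_real (r k) * w) \<noteq> 0"
      using r[of k] w by (intro nozero) (auto simp: norm_mult)
  next
    show "z \<in> ball 0 1" using z by simp
  qed (fact hol False open_ball connected_ball)+
qed

section \<open>Exchanging the two variables\<close>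

definition transp :: "(nat \<Rightarrow> nat \<Rightarrow> complex) \<Rightarrow> nat \<Rightarrow> nat \<Rightarrow> complex" where
  "transp a i j = a j i"

lemma poly2_transp: "poly2 (transp a) n m (w, z) = poly2 a m n (z, w)"
  unfolding poly2_def transp_def by (subst sum.swap) (simp add: mult_ac)

lemma refl2_transp: "refl2 (transp a) n m (w, z) = refl2 a m n (z, w)"
  unfolding refl2_def transp_def by (subst sum.swap) (simp add: mult_ac)

lemma finite_torus_zeros_transp:
  assumes "finite {z \<in> torus2. poly2 a m n z = 0}"
  shows "finite {z \<in> torus2. poly2 (transp a) n m z = 0}"
proof (rule finite_subset)
  show "{z \<in> torus2. poly2 (transp a) n m z = 0} \<subseteq> prod.swap ` {z \<in> torus2. poly2 a m n z = 0}"
  proof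
    fix x assume x: "x \<in> {z \<in> torus2. poly2 (transp a) n m z = 0}"
    obtain z w where zw: "x = (z, w)" by (cases x)
    have "(w, z) \<in> {z \<in> torus2. poly2 a m n z = 0}"
      using x unfolding zw by (simp add: torus2_def poly2_transp)
    then show "x \<in> prod.swap ` {z \<in> torus2. poly2 a m n z = 0}"
      unfolding zw by (rule rev_image_eqI) simp
  qed
qed (use assms in auto)

text \<open>Otherwise the denominator has no zero in the closed bidisk: mixed boundary points are
  excluded by Hurwitz, applied in either variable. The quotient would then be its own continuous
  extension.\<close>

lemma singular_torus_point_exists:
  assumes nozero: "\<forall>z\<in>bidisk. poly2 a m n z \<noteq> 0"
    and fin: "finite {z \<in> torus2. poly2 a m n z = 0}"
    and noext: "\<not> (\<exists>g. continuous_on closed_bidisk g \<and> (\<forall>z\<in>bidisk. g z = refl2 a m n z / poly2 a m n z))"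
  shows "\<exists>z\<in>torus2. poly2 a m n z = 0"
proof (rule ccontr)
  assume nt: "\<not> (\<exists>z\<in>torus2. poly2 a m n z = 0)"
  have nz: "poly2 a m n (z, w) \<noteq> 0" if "norm z < 1" "norm w < 1" for z w
    using nozero that by (auto simp: bidisk_def)
  have "poly2 a m n (z, w) \<noteq> 0" if zw: "norm z \<le> 1" "norm w \<le> 1" for z w
  proof -
    consider "norm z < 1" "norm w < 1" | "norm z < 1" "norm w = 1" | "norm z = 1" "norm w < 1"
      | "norm z = 1" "norm w = 1" using zw by linarith
    then show ?thesis
    proof cases
      case 1 then show ?thesis using nz by blast
    next
      case 2 show ?thesis by (rule poly2_nonzero_disc_times_circle[OF _ fin 2]) (rule nz)
    next
      case 3
      have "poly2 (transp a) n m (w, z) \<noteq> 0"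
        by (rule poly2_nonzero_disc_times_circle[OF _ finite_torus_zeros_transp[OF fin] 3(2,1)])
          (simp add: poly2_transp nz)
      then show ?thesis by (simp add: poly2_transp)
    next
      case 4 then show ?thesis using nt by (auto simp: torus2_def)
    qed
  qed
  then have "continuous_on closed_bidisk (\<lambda>z. refl2 a m n z / poly2 a m n z)"
    unfolding refl2_eq_poly2
    by (intro continuous_on_divide continuous_on_poly2) (auto simp: closed_bidisk_def)
  then show False using noext by blast
qed

subsection \<open>Integral estimates\<close>

lemma norm_cis_diff_le: "norm (cis s - cis t) \<le> \<bar>s - t\<bar>"
proof -
  have "cis s - cis t = cis t * (cis (s - t) - 1)"
    by (simp add: algebra_simps cis_mult)
  then have "norm (cis s - cis t) = norm (exp (\<i> * of_real (s - t)) - 1)"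
    by (simp add: norm_mult cis_conv_exp)
  also have "\<dots> = 2 * \<bar>sin ((s - t) / 2)\<bar>" by (rule dist_exp_i_1)
  also have "\<dots> \<le> \<bar>s - t\<bar>" using abs_sin_x_le_abs_x[of "(s - t) / 2"] by simp
  finally show ?thesis .
qed

lemma cis_neq_nearby: "0 < t - s \<Longrightarrow> t - s < 1 \<Longrightarrow> cis t \<noteq> cis s"
proof
  assume t: "0 < t - s" "t - s < 1" and "cis t = cis s"
  then have "cis (t - s) = 1" by (metis cis_divide cis_neq_zero divide_self)
  then have "norm (exp (\<i> * of_real (t - s)) - 1) = 0" by (simp add: cis_conv_exp)
  then have "sin ((t - s) / 2) = 0" using dist_exp_i_1[of "t - s"] by simp
  moreover have "sin ((t - s) / 2) > 0" using t pi_gt3 by (intro sin_gt_zero) auto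
  ultimately show False by simp
qed

text \<open>With \<open>e = norm b - 1\<close>, the kernel is at least \<open>1 / (2 * e)\<close> on
  an arc of length \<open>e\<close> at the argument of \<open>b\<close>. Its power 3/2 times the arc
  length is of order \<open>e powr (-1/2)\<close>.\<close>

lemma nn_integral_peak_lower_bound:
  fixes u :: "real \<Rightarrow> real" and b :: complex
  assumes b: "1 < norm b" "norm b \<le> 3/2" and P: "3/2 \<le> P"
    and u: "\<And>\<theta>. ((norm b)\<^sup>2 - 1) / (norm (cis \<theta> - b))\<^sup>2 \<le> u \<theta>"
  shows "ennreal (1 / (2 * sqrt (2 * (norm b - 1)))) \<le> (\<integral>\<^sup>+\<theta>\<in>{0..2*pi}. ennreal (u \<theta> powr P) \<partial>lborel)"
proof -
  define e where "e = norm b - 1"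
  have e: "0 < e" "e \<le> 1/2" using b by (auto simp: e_def)
  define s where "s = Arg2pi b"
  have s: "0 \<le> s" "s < 2 * pi" unfolding s_def using Arg2pi[of b] by auto
  have b_eq: "b = of_real (1 + e) * cis s"
    unfolding s_def e_def using Arg2pi_eq[of b] by (simp add: cis_conv_exp)
  \<comment> \<open>The arc extends to whichever side of \<open>s\<close> remains within
    \<open>{0..2*pi}\<close>.\<close>
  define I where "I = (if s \<le> pi then {s..s + e} else {s - e..s})"
  have I: "I \<subseteq> {0..2*pi}" unfolding I_def using s e pi_gt3 by auto
  have Is: "\<bar>\<theta> - s\<bar> \<le> e" if "\<theta> \<in> I" for \<theta> using that unfolding I_def by (auto split: if_splits)
  have [measurable]: "I \<in> sets borel" unfolding I_def by auto
  have emI: "emeasure lborel I = ennreal e" unfolding I_def using e by auto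
  have peak: "(1 / (2 * e)) powr (3/2) \<le> u \<theta> powr P" if "\<theta> \<in> I" for \<theta>
  proof -
    have "norm (cis \<theta> - b) \<le> norm (cis \<theta> - cis s) + norm (cis s - b)"
      using norm_triangle_ineq[of "cis \<theta> - cis s" "cis s - b"] by simp
    also have "norm (cis \<theta> - cis s) \<le> e" using norm_cis_diff_le Is[OF that] by (rule order.trans)
    also have "cis s - b = - of_real e * cis s" unfolding b_eq by (simp add: algebra_simps)
    also have "norm \<dots> = e" using e by (simp add: norm_mult)
    finally have d: "norm (cis \<theta> - b) \<le> 2 * e" by simp
    have pos: "0 < norm (cis \<theta> - b)" using b by auto
    have "1 / (2 * e) = (2 * e) / (2 * e)\<^sup>2" using e by (simp add: power2_eq_square)
    also have "\<dots> \<le> ((norm b)\<^sup>2 - 1) / (norm (cis \<theta> - b))\<^sup>2"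
    proof (rule frac_le)
      show "2 * e \<le> (norm b)\<^sup>2 - 1" unfolding e_def
        using b zero_le_power2[of "norm b - 1"] by (simp add: power2_eq_square algebra_simps)
      show "(norm (cis \<theta> - b))\<^sup>2 \<le> (2 * e)\<^sup>2" using d by (intro power_mono) auto
    qed (use pos b in auto)
    also have "\<dots> \<le> u \<theta>" by (rule u)
    finally have ue: "1 / (2 * e) \<le> u \<theta>" .
    \<comment> \<open>This uses \<open>e \<le> 1/2\<close>: powers with base at least 1 grow with
      the exponent, so \<open>P\<close> reduces to 3/2.\<close>
    have "1 \<le> 1 / (2 * e)" using e by simp
    also note ue
    finally have "u \<theta> powr (3/2) \<le> u \<theta> powr P" using P by (intro powr_mono) auto
    moreover have "(1 / (2 * e)) powr (3/2) \<le> u \<theta> powr (3/2)"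
      using e ue by (intro powr_mono2) auto
    ultimately show ?thesis by (rule order.trans[rotated])
  qed
  have "1 / (2 * sqrt (2 * e)) = (1 / (2 * e)) powr (3/2) * e"
  proof -
    have "(1 / (2 * e)) powr (3/2) = (1 / (2 * e)) powr (1 + 1/2)" by simp
    also have "\<dots> = (1 / (2 * e)) * (1 / sqrt (2 * e))"
      using e by (subst powr_add) (auto simp: powr_half_sqrt real_sqrt_divide)
    finally show ?thesis using e by simp
  qed
  then have "ennreal (1 / (2 * sqrt (2 * e))) = ennreal ((1 / (2 * e)) powr (3/2)) * emeasure lborel I"
    using e by (simp add: emI ennreal_mult)
  also have "\<dots> = (\<integral>\<^sup>+\<theta>. ennreal ((1 / (2 * e)) powr (3/2)) * indicator I \<theta> \<partial>lborel)"
    by (simp add: nn_integral_cmult_indicator)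
  also have "\<dots> \<le> (\<integral>\<^sup>+\<theta>\<in>{0..2*pi}. ennreal (u \<theta> powr P) \<partial>lborel)"
  proof (rule nn_integral_mono)
    fix \<theta>
    show "ennreal ((1 / (2 * e)) powr (3/2)) * indicator I \<theta> \<le> ennreal (u \<theta> powr P) * indicator {0..2*pi} \<theta>"
      using peak[of \<theta>] I by (auto split: split_indicator simp: ennreal_leI)
  qed
  finally show ?thesis unfolding e_def .
qed

lemma nn_integral_reciprocal_infinite:
  fixes k d s0 :: real
  assumes "k > 0" "d > 0"
  shows "(\<integral>\<^sup>+s\<in>{s0<..<s0 + d}. ennreal (k / (s - s0)) \<partial>lborel) = \<infinity>" (is "?I = _")
proof (rule ccontr)
  assume "?I \<noteq> \<infinity>"
  then obtain B where B: "?I = ennreal B" "B \<ge> 0" by (metis ennreal_cases infinity_ennreal_def)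
  \<comment> \<open>Chosen so that the integral from \<open>s0 + h\<close> to
    \<open>s0 + d/2\<close> equals \<open>B + 1\<close>; the endpoint \<open>d/2\<close> keeps the
    closed interval inside the open one.\<close>
  define h where "h = (d/2) * exp (- (B + 1) / k)"
  have "exp (- (B + 1) / k) \<le> 1" using assms B by (subst exp_le_one_iff) (simp add: divide_le_0_iff)
  then have h: "0 < h" "h \<le> d/2" unfolding h_def using assms by auto
  have "(\<integral>\<^sup>+s. ennreal (k / (s - s0)) * indicator {s0 + h..s0 + d/2} s \<partial>lborel) =
      k * ln (s0 + d/2 - s0) - k * ln (s0 + h - s0)"
    using h assms by (intro nn_integral_FTC_Icc) (auto intro!: derivative_eq_intros)
  also have "k * ln (s0 + d/2 - s0) - k * ln (s0 + h - s0) = B + 1"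
  proof -
    have "ln h = ln (d/2) - (B + 1) / k"
      unfolding h_def using assms by (subst ln_mult) (auto simp: diff_divide_distrib add_divide_distrib)
    then show ?thesis using assms by (simp add: right_diff_distrib)
  qed
  finally have "ennreal (B + 1) = (\<integral>\<^sup>+s. ennreal (k / (s - s0)) * indicator {s0 + h..s0 + d/2} s \<partial>lborel)"
    by (rule sym)
  also have "\<dots> \<le> ?I"
    using h assms by (intro nn_integral_mono) (auto split: split_indicator)
  finally have "ennreal (B + 1) \<le> ?I" .
  then show False using B by simp
qed

text \<open>Tonelli with the singular parameter in the second coordinate, as for the derivative in
  the first variable; the mirrored version below serves the other derivative.\<close>

lemma nn_integral_pair_infinite_snd:
  fixes g :: "real \<times> real \<Rightarrow> ennreal"
  assumes [measurable]: "g \<in> borel_measurable borel" and kd: "k > 0" "d > 0"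
    and lower: "\<And>s. s0 < s \<Longrightarrow> s < s0 + d \<Longrightarrow> ennreal (k / (s - s0)) \<le> (\<integral>\<^sup>+\<theta>. g (\<theta>, s) \<partial>lborel)"
  shows "(\<integral>\<^sup>+x. g x \<partial>lborel) = \<infinity>"
proof -
  have "\<infinity> = (\<integral>\<^sup>+s\<in>{s0<..<s0 + d}. ennreal (k / (s - s0)) \<partial>lborel)"
    using nn_integral_reciprocal_infinite[OF kd] by simp
  also have "\<dots> \<le> (\<integral>\<^sup>+s. (\<integral>\<^sup>+\<theta>. g (\<theta>, s) \<partial>lborel) \<partial>lborel)"
    using lower by (intro nn_integral_mono) (auto split: split_indicator)
  also have "\<dots> = integral\<^sup>N (lborel \<Otimes>\<^sub>M lborel) g"
    by (rule lborel_pair.nn_integral_snd) (simp add: lborel_prod)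
  finally show ?thesis by (simp add: lborel_prod top_unique)
qed

lemma nn_integral_pair_infinite_fst:
  fixes g :: "real \<times> real \<Rightarrow> ennreal"
  assumes [measurable]: "g \<in> borel_measurable borel" and kd: "k > 0" "d > 0"
    and lower: "\<And>s. s0 < s \<Longrightarrow> s < s0 + d \<Longrightarrow> ennreal (k / (s - s0)) \<le> (\<integral>\<^sup>+\<theta>. g (s, \<theta>) \<partial>lborel)"
  shows "(\<integral>\<^sup>+x. g x \<partial>lborel) = \<infinity>"
proof -
  have "\<infinity> = (\<integral>\<^sup>+s\<in>{s0<..<s0 + d}. ennreal (k / (s - s0)) \<partial>lborel)"
    using nn_integral_reciprocal_infinite[OF kd] by simp
  also have "\<dots> \<le> (\<integral>\<^sup>+s. (\<integral>\<^sup>+\<theta>. g (s, \<theta>) \<partial>lborel) \<partial>lborel)"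
    using lower by (intro nn_integral_mono) (auto split: split_indicator)
  also have "\<dots> = integral\<^sup>N (lborel \<Otimes>\<^sub>M lborel) g"
    by (rule lborel.nn_integral_fst) (simp add: lborel_prod)
  finally show ?thesis by (simp add: lborel_prod top_unique)
qed

text \<open>Fatou's lemma along radii tending to 1. For \<open>P = \<infinity>\<close> boundedness
  yields the claim with \<open>R = 3/2\<close>, the square of angles having finite measure. The
  rational function \<open>Q\<close> supplies the boundary values. Where it vanishes, the pointwise
  inequality is trivial, hence the form of \<open>cont\<close>.\<close>

lemma hardy2_finite_torus_integral:
  fixes Q :: "complex \<times> complex \<Rightarrow> complex"
  assumes hardy: "hardy2 P f" and P: "3/2 \<le> P"
    and eq: "\<And>z. z \<in> bidisk \<Longrightarrow> f z = Q z"
    and Q [measurable]: "Q \<in> borel_measurable borel"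
    and cont: "\<And>z. z \<in> torus2 \<Longrightarrow> Q z \<noteq> 0 \<Longrightarrow> isCont Q z"
  shows "\<exists>R\<ge>3/2. (\<integral>\<^sup>+x\<in>{0..2*pi} \<times> {0..2*pi}.
      ennreal (norm (Q (cis (fst x), cis (snd x))) powr R) \<partial>lborel) < \<infinity>"
proof -
  let ?S = "{0..2*pi} \<times> {0..2*pi} :: (real \<times> real) set"
  define q where "q = (\<lambda>R r x. ennreal (norm (Q (of_real r * cis (fst x), of_real r * cis (snd x))) powr R)
      * indicator ?S x)"
  have [measurable]: "?S \<in> sets borel" by (intro borel_closed closed_Times) auto
  have inb: "(of_real r * cis s, of_real r * cis t) \<in> bidisk" if "0 < r" "r < 1" for r s t
    using that by (simp add: bidisk_def norm_mult)
  have "\<exists>R K. 3/2 \<le> R \<and> K < \<infinity> \<and> (\<forall>r. 0 < r \<and> r < 1 \<longrightarrow> integral\<^sup>N lborel (q R r) \<le> K)"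
  proof (cases "P = \<infinity>")
    case True
    then obtain B where B: "\<And>z. z \<in> bidisk \<Longrightarrow> norm (f z) \<le> B"
      using hardy unfolding hardy2_def by auto
    have "integral\<^sup>N lborel (q (3/2) r) \<le> ennreal (B powr (3/2)) * emeasure lborel ?S" if r: "0 < r" "r < 1" for r
    proof -
      have "integral\<^sup>N lborel (q (3/2) r) \<le> (\<integral>\<^sup>+x. ennreal (B powr (3/2)) * indicator ?S x \<partial>lborel)"
      proof (rule nn_integral_mono)
        fix x :: "real \<times> real"
        have "norm (Q (of_real r * cis (fst x), of_real r * cis (snd x))) \<le> B"
          using B[OF inb[OF r]] eq[OF inb[OF r]] by simp
        then show "q (3/2) r x \<le> ennreal (B powr (3/2)) * indicator ?S x"
          unfolding q_def by (intro mult_right_mono ennreal_leI powr_mono2) auto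
      qed
      then show ?thesis by (simp add: nn_integral_cmult_indicator)
    qed
    moreover have "emeasure lborel ?S < \<infinity>"
      by (intro emeasure_bounded_finite bounded_Times) auto
    ultimately show ?thesis
      by (intro exI[of _ "3/2"] exI[of _ "ennreal (B powr (3/2)) * emeasure lborel ?S"])
        (auto simp: ennreal_mult_less_top)
  next
    case False
    define R where "R = real_of_ereal P"
    have "P = ereal R" using False P unfolding R_def by (cases P) auto
    then have R: "3/2 \<le> R" using P by (simp add: numeral_eq_ereal divide_ereal_def) 
    let ?c = "ennreal (1 / (4 * pi ^ 2))"
    define S where "S = (SUP r\<in>{0<..<1::real}. ?c * (\<integral>\<^sup>+ x \<in> ?S.
                 ennreal (norm (f (of_real r * cis (fst x), of_real r * cis (snd x))) powr R) \<partial>lborel))"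
    have S: "S < \<infinity>" using hardy False unfolding hardy2_def S_def R_def by auto
    have "integral\<^sup>N lborel (q R r) \<le> ennreal (4 * pi ^ 2) * S" if r: "0 < r" "r < 1" for r
    proof -
      have "?c * integral\<^sup>N lborel (q R r) = ?c * (\<integral>\<^sup>+ x \<in> ?S.
                 ennreal (norm (f (of_real r * cis (fst x), of_real r * cis (snd x))) powr R) \<partial>lborel)"
        unfolding q_def using eq[OF inb[OF r]] by simp
      also have "\<dots> \<le> S" unfolding S_def using r by (intro SUP_upper) auto
      \<comment> \<open>Removes the normalising constant of the Hardy norm.\<close>
      finally have "ennreal (4 * pi ^ 2) * (?c * integral\<^sup>N lborel (q R r)) \<le> ennreal (4 * pi ^ 2) * S"
        by (rule mult_left_mono) simp
      moreover have "ennreal (4 * pi ^ 2) * ?c = 1"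
        by (subst ennreal_mult[symmetric]) auto
      ultimately show ?thesis by (simp add: mult.assoc[symmetric])
    qed
    then show ?thesis using R S
      by (intro exI[of _ R] exI[of _ "ennreal (4 * pi ^ 2) * S"]) (auto simp: ennreal_mult_less_top)
  qed
  then obtain R K where R: "3/2 \<le> R" and K: "K < \<infinity>"
    and bound: "\<And>r. 0 < r \<Longrightarrow> r < 1 \<Longrightarrow> integral\<^sup>N lborel (q R r) \<le> K" by blast
  \<comment> \<open>The double \<open>Suc\<close> makes even the first radius positive.\<close>
  define r where "r = (\<lambda>k::nat. 1 - inverse (real (Suc (Suc k))))"
  have r: "0 < r k" "r k < 1" for k unfolding r_def by (auto simp: field_simps)
  have rlim: "r \<longlonglongrightarrow> 1"
    unfolding r_def using tendsto_diff[OF tendsto_const LIMSEQ_Suc[OF LIMSEQ_inverse_real_of_nat], of 1] by simp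
  have meas: "q R t \<in> borel_measurable lborel" for t
  proof -
    have "continuous_on UNIV (\<lambda>x::real \<times> real. (of_real t * cis (fst x), of_real t * cis (snd x)))"
      unfolding cis_conv_exp by (intro continuous_intros)
    then have [measurable]: "(\<lambda>x::real \<times> real. (of_real t * cis (fst x), of_real t * cis (snd x)))
        \<in> borel_measurable borel" by (rule borel_measurable_continuous_onI)
    show ?thesis unfolding q_def by measurable
  qed
  have pointwise: "q R 1 x \<le> liminf (\<lambda>k. q R (r k) x)" for x
  proof -
    let ?z = "(cis (fst x), cis (snd x))"
    show ?thesis
    proof (cases "Q ?z = 0 \<or> x \<notin> ?S")
      case True
      then have "q R 1 x = 0" unfolding q_def by auto
      then show ?thesis by simp
    next
      case False
      then have iso: "isCont Q ?z" by (intro cont) (auto simp: torus2_def)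
      have "(\<lambda>k. (of_real (r k) * cis (fst x), of_real (r k) * cis (snd x))) \<longlonglongrightarrow>
          (of_real 1 * cis (fst x), of_real 1 * cis (snd x))"
        by (intro tendsto_intros rlim)
      then have "(\<lambda>k. Q (of_real (r k) * cis (fst x), of_real (r k) * cis (snd x))) \<longlonglongrightarrow> Q ?z"
        by (intro isCont_tendsto_compose[OF iso]) simp
      then have "(\<lambda>k. q R (r k) x) \<longlonglongrightarrow> q R 1 x"
        unfolding q_def using False
        by (auto intro!: tendsto_ennrealI tendsto_powr tendsto_norm)
      then have "liminf (\<lambda>k. q R (r k) x) = q R 1 x"
        by (intro lim_imp_Liminf) auto
      then show ?thesis by simp
    qed
  qed
  have "integral\<^sup>N lborel (q R 1) \<le> (\<integral>\<^sup>+x. liminf (\<lambda>k. q R (r k) x) \<partial>lborel)"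
    by (intro nn_integral_mono pointwise)
  also have "\<dots> \<le> liminf (\<lambda>k. integral\<^sup>N lborel (q R (r k)))"
    by (intro nn_integral_liminf meas)
  also have "\<dots> \<le> limsup (\<lambda>k. integral\<^sup>N lborel (q R (r k)))"
    by (intro Liminf_le_Limsup) simp
  also have "\<dots> \<le> K" by (intro Limsup_bounded always_eventually allI bound r)
  also note K
  finally have "integral\<^sup>N lborel (q R 1) < \<infinity>" .
  then show ?thesis using R unfolding q_def by auto
qed

subsection \<open>Divergence of the boundary integrals\<close>

text \<open>Quadratic contact gives a root with \<open>norm b - 1 \<le> C * t\<^sup>2\<close> over
  the point at angle \<open>t = s - s0\<close> from \<open>v\<close>; the peak estimate of order
  \<open>(norm b - 1) powr (-1/2)\<close> then becomes \<open>k / t\<close>.\<close>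

lemma phi_d1_slice_integral_lower_bound:
  assumes nozero: "\<And>z w. norm z < 1 \<Longrightarrow> norm w < 1 \<Longrightarrow> poly2 a m n (z, w) \<noteq> 0"
    and fin: "finite {z \<in> torus2. poly2 a m n z = 0}"
    and c: "norm c = 1" and v: "norm v = 1" and zero: "poly2 a m n (c, v) = 0"
  shows "\<exists>s0 d k. 0 \<le> s0 \<and> 0 < d \<and> s0 + d \<le> 2 * pi \<and> 0 < k \<and>
    (\<forall>s P. s0 < s \<and> s < s0 + d \<and> 3/2 \<le> P \<longrightarrow> ennreal (k / (s - s0)) \<le>
      (\<integral>\<^sup>+\<theta>\<in>{0..2*pi}. ennreal (norm (phi_d1 a m n (cis \<theta>, cis s)) powr P) \<partial>lborel))"
proof -
  have nz: "poly2 a m n (z, w) \<noteq> 0" if "norm z < 1" "norm w = 1" for z w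
    by (rule poly2_nonzero_disc_times_circle[OF _ fin that]) (rule nozero)
  obtain C e where C: "C > 0" and e: "e > 0"
    and contact: "\<And>t::real. \<bar>t\<bar> < e \<Longrightarrow> \<exists>b. poly2 a m n (b, v * cis t) = 0 \<and> norm b \<le> 1 + C * t\<^sup>2"
    using boundary_root_quadratic_contact[OF _ c v zero slice_nonzero_on_circle[OF fin v]] nz by auto
  define s0 where "s0 = Arg2pi v"
  have s0: "0 \<le> s0" "s0 < 2 * pi" unfolding s0_def using Arg2pi[of v] by auto
  have v_eq: "v = cis s0"
    unfolding s0_def using v complex_norm_eq_1_exp[of v] by (simp add: cis_conv_exp)
  \<comment> \<open>Only finitely many slices over the circle have a zero on the circle. Within
    distance \<open>\<rho>\<close> of \<open>v\<close> the only such slice is the one over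
    \<open>v\<close>.\<close>
  define W where "W = snd ` {z \<in> torus2. poly2 a m n z = 0}"
  have "finite W" unfolding W_def using fin by blast
  then obtain \<rho> where \<rho>: "\<rho> > 0" "\<And>w. w \<in> ball v \<rho> \<Longrightarrow> w \<noteq> v \<Longrightarrow> w \<notin> W"
    using finite_ball_avoid[OF open_UNIV, of W v] by auto
  \<comment> \<open>In turn: the range of the contact estimate, angles staying below
    \<open>2 * pi\<close>, \<open>cis s \<noteq> v\<close> together with
    \<open>t\<^sup>2 \<le> t\<close>, avoidance of \<open>W\<close>, and
    \<open>C * t\<^sup>2 \<le> 1/2\<close>, which gives \<open>norm b \<le> 3/2\<close>.\<close>
  define d where "d = Min {e, 2 * pi - s0, 1, \<rho>, 1 / (2 * C)}"
  have d: "0 < d" "d \<le> e" "d \<le> 2 * pi - s0" "d \<le> 1" "d \<le> \<rho>" "d \<le> 1 / (2 * C)"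
    unfolding d_def using e s0 \<rho> C by auto
  \<comment> \<open>The peak bound \<open>1 / (2 * sqrt (2 * C * t\<^sup>2))\<close> equals
    \<open>k / t\<close>.\<close>
  define k where "k = 1 / (2 * sqrt (2 * C))"
  have k: "k > 0" unfolding k_def using C by simp
  have "ennreal (k / (s - s0)) \<le>
      (\<integral>\<^sup>+\<theta>\<in>{0..2*pi}. ennreal (norm (phi_d1 a m n (cis \<theta>, cis s)) powr P) \<partial>lborel)"
    if s: "s0 < s" "s < s0 + d" and P: "3/2 \<le> P" for s P
  proof -
    define t where "t = s - s0"
    have t: "0 < t" "t < d" using s t_def by auto
    have cis_s: "cis s = v * cis t" unfolding v_eq t_def by (simp add: cis_mult)
    have "cis s \<noteq> v" unfolding v_eq using t d unfolding t_def by (intro cis_neq_nearby) auto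
    moreover have "norm (cis s - v) < \<rho>"
      unfolding v_eq using norm_cis_diff_le[of s s0] t d unfolding t_def by linarith
    ultimately have "cis s \<notin> W" using \<rho>(2)[of "cis s"] by (simp add: dist_norm norm_minus_commute)
    then have circ: "poly2 a m n (z, cis s) \<noteq> 0" if "norm z = 1" for z
      using that unfolding W_def by (force simp: torus2_def)
    have disc: "poly2 a m n (z, cis s) \<noteq> 0" if "norm z \<le> 1" for z
      using nz[of z "cis s"] circ[of z] that by (cases "norm z = 1") auto
    obtain b where b: "poly2 a m n (b, cis s) = 0" "norm b \<le> 1 + C * t\<^sup>2"
      using contact[of t] t d unfolding cis_s by auto
    have b1: "1 < norm b" using disc b(1) by force
    have "C * t\<^sup>2 \<le> C * (1 / (2 * C))"
    proof (rule mult_left_mono)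
      have "t\<^sup>2 \<le> t" using t d by (simp add: power2_eq_square mult_left_le)
      also have "t \<le> 1 / (2 * C)" using t d by simp
      finally show "t\<^sup>2 \<le> 1 / (2 * C)" .
    qed (use C in simp)
    then have b2: "norm b \<le> 3/2" using b(2) C by simp
    have "k / t \<le> 1 / (2 * sqrt (2 * (norm b - 1)))"
    proof -
      have "sqrt (2 * (norm b - 1)) \<le> sqrt (2 * C * t\<^sup>2)"
        using b(2) by (intro real_sqrt_le_mono) simp
      also have "\<dots> = sqrt (2 * C) * t" using t by (simp add: real_sqrt_mult)
      finally have "1 / (2 * (sqrt (2 * C) * t)) \<le> 1 / (2 * sqrt (2 * (norm b - 1)))"
        using b1 by (intro divide_left_mono mult_pos_pos) (use C t in auto)
      then show ?thesis unfolding k_def by simp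
    qed
    then have "ennreal (k / t) \<le> ennreal (1 / (2 * sqrt (2 * (norm b - 1))))" by (rule ennreal_leI)
    also have "\<dots> \<le> (\<integral>\<^sup>+\<theta>\<in>{0..2*pi}. ennreal (norm (phi_d1 a m n (cis \<theta>, cis s)) powr P) \<partial>lborel)"
      by (rule nn_integral_peak_lower_bound[OF b1 b2 P norm_phi_d1_ge[OF _ disc b(1)]]) auto
    finally show ?thesis unfolding t_def .
  qed
  then show ?thesis using s0 d k by (intro exI[of _ s0] exI[of _ d] exI[of _ k]) auto
qed

section \<open>Regularity of \<open>phi_d1\<close> and its identification with the partial
  derivatives\<close>

lemma borel_measurable_phi_d1 [measurable]: "phi_d1 a m n \<in> borel_measurable borel"
proof -
  have [measurable]: "poly2 b m n \<in> borel_measurable borel" "poly2_d1 b m n \<in> borel_measurable borel" for b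
    by (intro borel_measurable_continuous_onI continuous_on_poly2 continuous_on_poly2_d1)+
  show ?thesis unfolding phi_d1_def refl2_eq_poly2 by measurable
qed

text \<open>A nonzero value rules out a zero of the denominator, since there division by zero would
  give 0.\<close>

lemma isCont_phi_d1:
  assumes "phi_d1 a m n z \<noteq> 0"
  shows "isCont (phi_d1 a m n) z"
proof -
  have "isCont (poly2 b m n) z" "isCont (poly2_d1 b m n) z" for b
    using continuous_on_poly2[of UNIV b m n] continuous_on_poly2_d1[of UNIV b m n]
    by (metis UNIV_I continuous_on_eq_continuous_at open_UNIV)+
  moreover have "poly2 a m n z \<noteq> 0" using assms unfolding phi_d1_def by auto
  ultimately show ?thesis
    unfolding phi_d1_def refl2_eq_poly2 by (intro continuous_intros) auto
qed

lemma pderiv1_eq_phi_d1: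
  assumes "poly2 a m n z \<noteq> 0"
  shows "pderiv1 (\<lambda>z. refl2 a m n z / poly2 a m n z) z = phi_d1 a m n z"
proof -
  obtain x y where z: "z = (x, y)" by (cases z)
  have "((\<lambda>w. refl2 a m n (w, y) / poly2 a m n (w, y)) has_field_derivative phi_d1 a m n (x, y)) (at x)"
    unfolding phi_d1_def refl2_eq_poly2 power2_eq_square
    using assms z by (intro DERIV_divide poly2_has_derivative_1) auto
  then show ?thesis unfolding pderiv1_def z by (simp add: DERIV_imp_deriv)
qed

lemma pderiv2_eq_phi_d1_transp:
  assumes "poly2 a m n z \<noteq> 0"
  shows "pderiv2 (\<lambda>z. refl2 a m n z / poly2 a m n z) z = phi_d1 (transp a) n m (prod.swap z)"
proof -
  have "pderiv2 (\<lambda>z. refl2 a m n z / poly2 a m n z) z =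
      pderiv1 (\<lambda>z. refl2 (transp a) n m z / poly2 (transp a) n m z) (prod.swap z)"
    unfolding pderiv1_def pderiv2_def by (simp add: poly2_transp refl2_transp)
  also have "\<dots> = phi_d1 (transp a) n m (prod.swap z)"
    using assms by (intro pderiv1_eq_phi_d1) (cases z, simp add: poly2_transp)
  finally show ?thesis .
qed

lemma indicator_square: "indicator ({0..2*pi} \<times> {0..2*pi}) (x, y) =
    (indicator {0..2*pi} x * indicator {0..2*pi} y :: ennreal)" for x y :: real
  by (simp add: indicator_times)

theorem theorem5p1:
  fixes a :: "nat \<Rightarrow> nat \<Rightarrow> complex" and m n :: nat and \<phi> :: "complex \<times> complex \<Rightarrow> complex"
  assumes bideg: "has_bidegree a m n"
    and nozero: "\<forall>z\<in>bidisk. poly2 a m n z \<noteq> 0"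
    and atoral: "atoral a m n"
    and phi_def: "\<phi> = (\<lambda>z. refl2 a m n z / poly2 a m n z)"
    and noext: "\<not> (\<exists>g. continuous_on closed_bidisk g \<and> (\<forall>z\<in>bidisk. g z = \<phi> z))"
  shows "\<forall>P::ereal. 3/2 \<le> P \<longrightarrow> \<not> hardy2 P (pderiv1 \<phi>) \<and> \<not> hardy2 P (pderiv2 \<phi>)"
proof (intro allI impI conjI notI)
  fix P :: ereal assume P: "3/2 \<le> P"
  have fin: "finite {z \<in> torus2. poly2 a m n z = 0}" using atoral by (simp add: atoral_def)
  have nz: "poly2 a m n (z, w) \<noteq> 0" if "norm z < 1" "norm w < 1" for z w
    using nozero that by (auto simp: bidisk_def)
  obtain c v where cv: "norm c = 1" "norm v = 1" "poly2 a m n (c, v) = 0"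
    using singular_torus_point_exists[OF nozero fin] noext unfolding phi_def torus2_def by auto
  have cisc: "continuous_on UNIV (\<lambda>x::real \<times> real. (cis (fst x), cis (snd x)))"
    unfolding cis_conv_exp by (intro continuous_intros)
  then have [measurable]: "(\<lambda>x::real \<times> real. (cis (fst x), cis (snd x))) \<in> borel_measurable borel"
    by (rule borel_measurable_continuous_onI)
  have cisc': "continuous_on UNIV (\<lambda>x::real \<times> real. (cis (snd x), cis (fst x)))"
    unfolding cis_conv_exp by (intro continuous_intros)
  then have [measurable]: "(\<lambda>x::real \<times> real. (cis (snd x), cis (fst x))) \<in> borel_measurable borel"
    by (rule borel_measurable_continuous_onI)
  have [measurable]: "({0..2*pi} \<times> {0..2*pi} :: (real \<times> real) set) \<in> sets borel"
    by (intro borel_closed closed_Times) auto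
  {
    assume hardy: "hardy2 P (pderiv1 \<phi>)"
    have eq: "pderiv1 \<phi> z = phi_d1 a m n z" if "z \<in> bidisk" for z
      unfolding phi_def using nozero that by (intro pderiv1_eq_phi_d1) blast
    obtain R where R: "3/2 \<le> R" and finite_integral: "(\<integral>\<^sup>+x\<in>{0..2*pi} \<times> {0..2*pi}.
        ennreal (norm (phi_d1 a m n (cis (fst x), cis (snd x))) powr R) \<partial>lborel) < \<infinity>"
      using hardy2_finite_torus_integral[OF hardy P eq borel_measurable_phi_d1 isCont_phi_d1] by blast
    obtain s0 d k where s: "0 \<le> s0" "0 < d" "s0 + d \<le> 2 * pi" "0 < k"
      and lower: "\<And>s P. s0 < s \<Longrightarrow> s < s0 + d \<Longrightarrow> 3/2 \<le> P \<Longrightarrow> ennreal (k / (s - s0)) \<le>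
        (\<integral>\<^sup>+\<theta>\<in>{0..2*pi}. ennreal (norm (phi_d1 a m n (cis \<theta>, cis s)) powr P) \<partial>lborel)"
      using phi_d1_slice_integral_lower_bound[OF nz fin cv] by blast
    have "(\<integral>\<^sup>+x\<in>{0..2*pi} \<times> {0..2*pi}.
        ennreal (norm (phi_d1 a m n (cis (fst x), cis (snd x))) powr R) \<partial>lborel) = \<infinity>"
    proof (rule nn_integral_pair_infinite_snd[OF _ s(4,2)])
      fix s assume "s0 < s" "s < s0 + d"
      then show "ennreal (k / (s - s0)) \<le> (\<integral>\<^sup>+\<theta>. ennreal (norm (phi_d1 a m n
          (cis (fst (\<theta>, s)), cis (snd (\<theta>, s)))) powr R) * indicator ({0..2*pi} \<times> {0..2*pi}) (\<theta>, s) \<partial>lborel)"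
        using lower[of s R] R s by (simp add: indicator_square)
    qed measurable
    then show False using finite_integral by simp
  }
  {
    \<comment> \<open>The derivative in the second variable becomes \<open>phi_d1\<close> of the
      transposed polynomial at the swapped point; the torus zero becomes
      \<open>(v, c)\<close>.\<close>
    assume hardy: "hardy2 P (pderiv2 \<phi>)"
    let ?b = "transp a"
    have sw [measurable]: "(prod.swap :: complex \<times> complex \<Rightarrow> _) \<in> borel_measurable borel"
      by (intro borel_measurable_continuous_onI continuous_on_swap)
    have isw: "isCont prod.swap z" for z :: "complex \<times> complex"
      using continuous_on_swap[of UNIV] by (metis UNIV_I continuous_on_eq_continuous_at open_UNIV)
    have "\<exists>R\<ge>3/2. (\<integral>\<^sup>+x\<in>{0..2*pi} \<times> {0..2*pi}.
        ennreal (norm (phi_d1 ?b n m (prod.swap (cis (fst x), cis (snd x)))) powr R) \<partial>lborel) < \<infinity>"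
    proof (rule hardy2_finite_torus_integral[OF hardy P])
      show "(\<lambda>z. phi_d1 ?b n m (prod.swap z)) \<in> borel_measurable borel" by measurable
      show "pderiv2 \<phi> z = phi_d1 ?b n m (prod.swap z)" if "z \<in> bidisk" for z
        unfolding phi_def using nozero that by (intro pderiv2_eq_phi_d1_transp) blast
      show "isCont (\<lambda>z. phi_d1 ?b n m (prod.swap z)) z" if "phi_d1 ?b n m (prod.swap z) \<noteq> 0" for z
        by (rule isCont_o2[OF isw isCont_phi_d1[OF that]])
    qed
    then obtain R where R: "3/2 \<le> R" and finite_integral: "(\<integral>\<^sup>+x\<in>{0..2*pi} \<times> {0..2*pi}.
        ennreal (norm (phi_d1 ?b n m (cis (snd x), cis (fst x))) powr R) \<partial>lborel) < \<infinity>"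
      by auto
    obtain s0 d k where s: "0 \<le> s0" "0 < d" "s0 + d \<le> 2 * pi" "0 < k"
      and lower: "\<And>s P. s0 < s \<Longrightarrow> s < s0 + d \<Longrightarrow> 3/2 \<le> P \<Longrightarrow> ennreal (k / (s - s0)) \<le>
        (\<integral>\<^sup>+\<theta>\<in>{0..2*pi}. ennreal (norm (phi_d1 ?b n m (cis \<theta>, cis s)) powr P) \<partial>lborel)"
      using phi_d1_slice_integral_lower_bound[OF _ finite_torus_zeros_transp[OF fin] cv(2,1)] nz cv(3)
      by (auto simp: poly2_transp)
    have "(\<integral>\<^sup>+x\<in>{0..2*pi} \<times> {0..2*pi}.
        ennreal (norm (phi_d1 ?b n m (cis (snd x), cis (fst x))) powr R) \<partial>lborel) = \<infinity>"
    \<comment> \<open>After the swap the singular angle \<open>s\<close> is the first integration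
      variable.\<close>
    proof (rule nn_integral_pair_infinite_fst[OF _ s(4,2)])
      fix s assume "s0 < s" "s < s0 + d"
      then show "ennreal (k / (s - s0)) \<le> (\<integral>\<^sup>+\<theta>. ennreal (norm (phi_d1 ?b n m
          (cis (snd (s, \<theta>)), cis (fst (s, \<theta>)))) powr R) * indicator ({0..2*pi} \<times> {0..2*pi}) (s, \<theta>) \<partial>lborel)"
        using lower[of s R] R s by (simp add: indicator_square)
    qed measurable
    then show False using finite_integral by simp
  }
qed

end
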